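(* Let $H$ be an equationally noetherian group and let $G$ be a finitely generated $H$-limit group. Then for any finite subset $X\subseteq G\setminus\{1\}$ and for any ordinal $\gamma$ with $1\le\gamma\le Rk(G)$, there exists an epimorphism $f:G\to L$ such that $L$ is an $H$-limit group with $Rk(L)=\gamma$ and $1\notin f(X)$.
   Context: Equationally noetherian: for a group $H$ and $\bar x=(x_1,\dots,x_n)$ let $H[\bar x]=H*F(\bar x)$, with $F(\bar x)$ free on $x_1,\dots,x_n$; for $S\subseteq H[\bar x]$ let $V(S)=\{\bar g\in H^n : s(\bar g)=1\text{ for all }s\in S\}$. $H$ is equationally noetherian if for every $n\ge1$ and every $S\subseteq H[\bar x]$ there is a finite $S_0\subseteq S$ with $V(S)=V(S_0)$. A finitely generated group $G$ is an $H$-limit group if it is a model of the universal theory $\mathrm{Th}_\forall(H)$ of $H$ (language $L$ of groups; the symbol $L$ in the claim denotes a group); $H$-limit groups are finitely generated by definition. Rank $Rk$, taken relative to the theory $T=\mathrm{Th}_\forall(H)$. Write $\mathcal L$ for the language of groups. Let $\bar c=(c_1,\dots,c_n)$ be new constants and $\mathcal L_n(\bar c)=\mathcal L\cup\{c_1,\dots,c_n\}$; $(\mathcal M,\bar a)$ denotes the expansion of $\mathcal M$ interpreting $\bar c$ by $\bar a$. Let $p_n(y)=\{y\ne\tau(\bar c):\tau(\bar x)\text{ an }\mathcal L\text{-term},\ |\bar x|=n\}$; $(\mathcal M,\bar a)$ omits $p_n$ (no element realizes it) iff $\bar a$ generates $\mathcal M$. If the $n$-tuple $\bar a$ generates $\mathcal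 M$, let $p_{\bar a,\forall}(\mathcal M)=\{\phi(\bar c):\phi(\bar x)\text{ a universal }\mathcal L\text{-formula},\ \mathcal M\models\phi(\bar a)\}$, a set of $\mathcal L_n(\bar c)$-sentences viewed as a type in no variables (realized by a structure iff all its sentences hold, omitted otherwise). For a set $P$ of types, $\mathcal K(T|P)$ is the class of $\mathcal L_n(\bar c)$-structures that are models of $T$ and omit every $p\in P$. $p_{\bar a,\forall}(\mathcal M)$ is existentially supported over a class $\mathcal K$ if there is an existential $\mathcal L_n(\bar c)$-sentence that holds in some member of $\mathcal K$ and such that every member of $\mathcal K$ satisfying it realizes $p_{\bar a,\forall}(\mathcal M)$. For an $n$-generated model $\mathcal M$ of $T$ and an ordinal $\alpha\ge1$ define inductively: $Rk_n(\mathcal M)=\alpha$ iff for every $n$-tuple $\bar a$ generating $\mathcal M$, $p_{\bar a,\forall}(\mathcal M)$ is existentially supported over $\mathcal K(T|Q_{n,\alpha})$, where $Q_{n,1}=\{p_n\}$ and, for $\alpha\ge2$, $Q_{n,\alpha}=\{p_n\}\cup\{p_{\bar b,\forall}(\mathcal N):\mathcal N\models T,\ \bar b\text{ an }n\text{-tuple generating }\mathcal N,\ Rk_n(\mathcal N)<\alpha\}$; $Rk_n(\mathcal M)=\infty$ if there is no such ordinal ($\infty$ is larger than every ordinal). The value does not depend on $n$ and is denoted $Rk(\mathcal M)$. *)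

theory Defs
  imports "HOL-Algebra.Generated_Groups" "HOL-Library.Extended"
begin

section \<open>The group \<open>H[x\<^sub>1,\<dots>,x\<^sub>n] = H * F(x\<^sub>1,\<dots>,x\<^sub>n)\<close> and equationally noetherian groups\<close>

text \<open>The free product is built as words over \<open>H\<close> and \<open>x\<^sub>i\<^sup>\<plusminus>\<^sup>1\<close>, modulo the congruence
  generated by the multiplication table of \<open>H\<close> and free cancellation. The letter \<open>Gen i True\<close> is
  the variable with index \<open>i\<close> (counted from \<open>0\<close>), and \<open>Gen i False\<close> is its inverse.\<close>

datatype 'h letter = Coef 'h | Gen nat bool

definition ext_words :: "('h, 'r) monoid_scheme \<Rightarrow> nat \<Rightarrow> 'h letter list set" where
  "ext_words H n = lists (Coef ` carrier H \<union> {Gen i b | i b. i < n})"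

inductive_set ext_red :: "('h, 'r) monoid_scheme \<Rightarrow> nat \<Rightarrow> ('h letter list \<times> 'h letter list) set"
  for H :: "('h, 'r) monoid_scheme" and n :: nat where
  unit: "\<lbrakk>u \<in> ext_words H n; v \<in> ext_words H n\<rbrakk> \<Longrightarrow> (u @ [Coef \<one>\<^bsub>H\<^esub>] @ v, u @ v) \<in> ext_red H n"
| mult: "\<lbrakk>u \<in> ext_words H n; v \<in> ext_words H n; g \<in> carrier H; h \<in> carrier H\<rbrakk>
    \<Longrightarrow> (u @ [Coef g, Coef h] @ v, u @ [Coef (g \<otimes>\<^bsub>H\<^esub> h)] @ v) \<in> ext_red H n"
| cancel: "\<lbrakk>u \<in> ext_words H n; v \<in> ext_words H n; i < n\<rbrakk>
    \<Longrightarrow> (u @ [Gen i b, Gen i (\<not> b)] @ v, u @ v) \<in> ext_red H n"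

definition ext_cong :: "('h, 'r) monoid_scheme \<Rightarrow> nat \<Rightarrow> ('h letter list \<times> 'h letter list) set" where
  "ext_cong H n = (ext_red H n \<union> (ext_red H n)\<inverse>)\<^sup>* \<inter> (ext_words H n \<times> ext_words H n)"

definition free_ext :: "('h, 'r) monoid_scheme \<Rightarrow> nat \<Rightarrow> 'h letter list set monoid" where
  "free_ext H n =
    \<lparr> carrier = ext_words H n // ext_cong H n,
      monoid.mult = (\<lambda>A B. \<Union>u\<in>A. \<Union>v\<in>B. ext_cong H n `` {u @ v}),
      one = ext_cong H n `` {[]} \<rparr>"

fun letter_val :: "('h, 'r) monoid_scheme \<Rightarrow> 'h list \<Rightarrow> 'h letter \<Rightarrow> 'h" where
  "letter_val H g (Coef h) = h"
| "letter_val H g (Gen i b) = (if b then g ! i else inv\<^bsub>H\<^esub> (g ! i))"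

definition word_val :: "('h, 'r) monoid_scheme \<Rightarrow> 'h list \<Rightarrow> 'h letter list \<Rightarrow> 'h" where
  "word_val H g w = foldr (\<lambda>l x. letter_val H g l \<otimes>\<^bsub>H\<^esub> x) w \<one>\<^bsub>H\<^esub>"

text \<open>\<open>ext_val H g s\<close> is \<open>s(g)\<close>, the common value of the words in the class \<open>s\<close>
  (see \<open>ext_val_class\<close> and \<open>ext_val_hom\<close> below).\<close>

definition ext_val :: "('h, 'r) monoid_scheme \<Rightarrow> 'h list \<Rightarrow> 'h letter list set \<Rightarrow> 'h" where
  "ext_val H g s = the_elem (word_val H g ` s)"

definition solution_set :: "('h, 'r) monoid_scheme \<Rightarrow> nat \<Rightarrow> 'h letter list set set \<Rightarrow> 'h list set" where
  "solution_set H n S =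
    {g. length g = n \<and> set g \<subseteq> carrier H \<and> (\<forall>s\<in>S. ext_val H g s = \<one>\<^bsub>H\<^esub>)}"

definition equationally_noetherian :: "('h, 'r) monoid_scheme \<Rightarrow> bool" where
  "equationally_noetherian H \<longleftrightarrow>
    (\<forall>n\<ge>1. \<forall>S \<subseteq> carrier (free_ext H n).
       \<exists>S0 \<subseteq> S. finite S0 \<and> solution_set H n S = solution_set H n S0)"

lemma ext_words_simps [simp]:
  "[] \<in> ext_words H n"
  "u @ v \<in> ext_words H n \<longleftrightarrow> u \<in> ext_words H n \<and> v \<in> ext_words H n"
  "Coef h # u \<in> ext_words H n \<longleftrightarrow> h \<in> carrier H \<and> u \<in> ext_words H n"
  "Gen i b # u \<in> ext_words H n \<longleftrightarrow> i < n \<and> u \<in> ext_words H n"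
  by (auto simp: ext_words_def)

lemma ext_cong_equiv: "equiv (ext_words H n) (ext_cong H n)"
proof (rule equivI)
  show "ext_cong H n \<subseteq> ext_words H n \<times> ext_words H n" by (auto simp: ext_cong_def)
  show "refl_on (ext_words H n) (ext_cong H n)" by (auto simp: ext_cong_def refl_on_def)
  have "sym ((ext_red H n \<union> (ext_red H n)\<inverse>)\<^sup>*)"
    by (intro sym_rtrancl) (auto simp: sym_def)
  then show "sym (ext_cong H n)" by (auto simp: ext_cong_def sym_def)
  show "trans (ext_cong H n)" by (auto simp: ext_cong_def trans_def)
qed

lemma ext_red_context:
  assumes "(u, v) \<in> ext_red H n" "p \<in> ext_words H n" "q \<in> ext_words H n"
  shows "(p @ u @ q, p @ v @ q) \<in> ext_red H n"
  using assms(1)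
proof cases
  case (unit a b)
  then show ?thesis using ext_red.unit[of "p @ a" H n "b @ q"] assms by simp
next
  case (mult a b g h)
  then show ?thesis using ext_red.mult[of "p @ a" H n "b @ q" g h] assms by simp
next
  case (cancel a b i c)
  then show ?thesis using ext_red.cancel[of "p @ a" H n "b @ q" i c] assms by simp
qed

lemma ext_cong_context:
  assumes "(u, v) \<in> ext_cong H n" "p \<in> ext_words H n" "q \<in> ext_words H n"
  shows "(p @ u @ q, p @ v @ q) \<in> ext_cong H n"
proof -
  have "(u, v) \<in> (ext_red H n \<union> (ext_red H n)\<inverse>)\<^sup>*" using assms(1) by (simp add: ext_cong_def)
  then have "(p @ u @ q, p @ v @ q) \<in> (ext_red H n \<union> (ext_red H n)\<inverse>)\<^sup>*"
  proof induction
    case (step y z)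
    have "(p @ y @ q, p @ z @ q) \<in> ext_red H n \<union> (ext_red H n)\<inverse>"
      using step(2) ext_red_context assms(2,3) by blast
    with step.IH show ?case by (rule rtrancl_into_rtrancl)
  qed simp
  then show ?thesis using assms by (auto simp: ext_cong_def)
qed

lemma ext_cong_append:
  assumes "(u, u') \<in> ext_cong H n" "(v, v') \<in> ext_cong H n"
  shows "(u @ v, u' @ v') \<in> ext_cong H n"
proof -
  have W: "u \<in> ext_words H n" "u' \<in> ext_words H n" "v \<in> ext_words H n" "v' \<in> ext_words H n"
    using assms by (auto simp: ext_cong_def)
  have "(u @ v, u' @ v) \<in> ext_cong H n"
    using ext_cong_context[OF assms(1), of "[]" v] W by simp
  moreover have "(u' @ v, u' @ v') \<in> ext_cong H n"
    using ext_cong_context[OF assms(2), of u' "[]"] W by simp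
  ultimately show ?thesis using ext_cong_equiv[of H n] by (meson equivE transE)
qed

lemma ext_mult_class:
  assumes "u \<in> ext_words H n" "v \<in> ext_words H n"
  shows "ext_cong H n `` {u} \<otimes>\<^bsub>free_ext H n\<^esub> ext_cong H n `` {v} = ext_cong H n `` {u @ v}"
proof -
  have "congruent2 (ext_cong H n) (ext_cong H n) (\<lambda>u v. ext_cong H n `` {u @ v})"
    using ext_cong_append equiv_class_eq[OF ext_cong_equiv]
    by (intro congruent2I') blast
  then show ?thesis
    using UN_equiv_class2[OF ext_cong_equiv ext_cong_equiv] assms
    by (simp add: free_ext_def)
qed

lemma free_ext_carrierE:
  assumes "A \<in> carrier (free_ext H n)"
  obtains u where "u \<in> ext_words H n" "A = ext_cong H n `` {u}"
  using assms by (auto simp: free_ext_def quotient_def)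

lemma free_ext_carrierI: "u \<in> ext_words H n \<Longrightarrow> ext_cong H n `` {u} \<in> carrier (free_ext H n)"
  by (simp add: free_ext_def quotientI)

context group
begin

lemma ext_word_inverse:
  assumes "w \<in> ext_words G n"
  shows "\<exists>w' \<in> ext_words G n. (w' @ w, []) \<in> ext_cong G n"
  using assms
proof (induction w)
  case Nil
  have "([] @ [], []) \<in> ext_cong G n" by (simp add: ext_cong_def)
  then show ?case using ext_words_simps(1) by blast
next
  case (Cons l w)
  have w: "w \<in> ext_words G n" using Cons.prems by (cases l) auto
  then obtain w' where w': "w' \<in> ext_words G n" "(w' @ w, []) \<in> ext_cong G n"
    using Cons.IH by blast
  have "\<exists>l'. [l'] \<in> ext_words G n \<and> ([l', l], []) \<in> ext_cong G n"
  proof (cases l)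
    case (Coef h)
    then have h: "h \<in> carrier G" using Cons.prems by simp
    have 1: "([Coef (inv h), Coef h], [Coef \<one>]) \<in> ext_red G n"
      using ext_red.mult[of "[]" G n "[]" "inv h" h] h by simp
    have 2: "([Coef \<one>], []) \<in> ext_red G n"
      using ext_red.unit[of "[]" G n "[]"] by simp
    have "([Coef (inv h), Coef h], []) \<in> (ext_red G n \<union> (ext_red G n)\<inverse>)\<^sup>*"
      using 1 2 by (meson UnI1 r_into_rtrancl rtrancl_into_rtrancl)
    then show ?thesis using h Coef by (intro exI[of _ "Coef (inv h)"]) (simp add: ext_cong_def)
  next
    case (Gen i b)
    then have i: "i < n" using Cons.prems by simp
    have "([Gen i (\<not> b), Gen i b], []) \<in> ext_red G n"
      using ext_red.cancel[of "[]" G n "[]" i "\<not> b"] i by simp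
    then show ?thesis using i Gen
      by (intro exI[of _ "Gen i (\<not> b)"]) (auto simp: ext_cong_def)
  qed
  then obtain l' where l': "[l'] \<in> ext_words G n" "([l', l], []) \<in> ext_cong G n" by blast
  have "(w' @ [l', l] @ w, w' @ [] @ w) \<in> ext_cong G n"
    using ext_cong_context[OF l'(2) w'(1) w] .
  then have "((w' @ [l']) @ l # w, []) \<in> ext_cong G n"
    using w'(2) ext_cong_equiv[of G n] by (simp) (meson equivE transE)
  moreover have "w' @ [l'] \<in> ext_words G n" using w' l' by simp
  ultimately show ?case by blast
qed

lemma free_ext_group: "group (free_ext G n)"
proof (rule groupI)
  have one: "\<one>\<^bsub>free_ext G n\<^esub> = ext_cong G n `` {[]}" by (simp add: free_ext_def)
  show "\<one>\<^bsub>free_ext G n\<^esub> \<in> carrier (free_ext G n)" by (simp add: one free_ext_carrierI)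
  fix A assume A: "A \<in> carrier (free_ext G n)"
  then obtain u where u: "u \<in> ext_words G n" "A = ext_cong G n `` {u}"
    by (rule free_ext_carrierE)
  show "\<one>\<^bsub>free_ext G n\<^esub> \<otimes>\<^bsub>free_ext G n\<^esub> A = A" using u ext_mult_class[of "[]" G n u] one by simp
  obtain u' where u': "u' \<in> ext_words G n" "(u' @ u, []) \<in> ext_cong G n"
    using ext_word_inverse u by blast
  then have "ext_cong G n `` {u'} \<otimes>\<^bsub>free_ext G n\<^esub> A = \<one>\<^bsub>free_ext G n\<^esub>"
    using u ext_mult_class[of u' G n u] equiv_class_eq[OF ext_cong_equiv u'(2)] one by simp
  then show "\<exists>y\<in>carrier (free_ext G n). y \<otimes>\<^bsub>free_ext G n\<^esub> A = \<one>\<^bsub>free_ext G n\<^esub>"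
    using free_ext_carrierI[OF u'(1)] by blast
  fix B assume "B \<in> carrier (free_ext G n)"
  then obtain v where v: "v \<in> ext_words G n" "B = ext_cong G n `` {v}"
    by (rule free_ext_carrierE)
  show "A \<otimes>\<^bsub>free_ext G n\<^esub> B \<in> carrier (free_ext G n)"
    using u v by (simp add: ext_mult_class free_ext_carrierI)
  fix C assume "C \<in> carrier (free_ext G n)"
  then obtain w where w: "w \<in> ext_words G n" "C = ext_cong G n `` {w}"
    by (rule free_ext_carrierE)
  show "A \<otimes>\<^bsub>free_ext G n\<^esub> B \<otimes>\<^bsub>free_ext G n\<^esub> C = A \<otimes>\<^bsub>free_ext G n\<^esub> (B \<otimes>\<^bsub>free_ext G n\<^esub> C)"
    using u v w by (simp add: ext_mult_class)
qed

context
  fixes n :: nat and g :: "'a list"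
  assumes g: "length g = n" "set g \<subseteq> carrier G"
begin

lemma word_val_simps [simp]:
  "word_val G g [] = \<one>"
  "word_val G g (l # w) = letter_val G g l \<otimes> word_val G g w"
  by (simp_all add: word_val_def)

lemma letter_val_closed: "[l] \<in> ext_words G n \<Longrightarrow> letter_val G g l \<in> carrier G"
  using g by (cases l) (auto simp: subset_iff)

lemma word_val_closed: "w \<in> ext_words G n \<Longrightarrow> word_val G g w \<in> carrier G"
proof (induction w)
  case (Cons l w)
  then have "[l] \<in> ext_words G n" "w \<in> ext_words G n" by (cases l; simp)+
  then show ?case using Cons.IH letter_val_closed by simp
qed simp

lemma word_val_append:
  "\<lbrakk>u \<in> ext_words G n; v \<in> ext_words G n\<rbrakk>
    \<Longrightarrow> word_val G g (u @ v) = word_val G g u \<otimes> word_val G g v"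
proof (induction u)
  case Nil
  then show ?case using word_val_closed by simp
next
  case (Cons l u)
  then have "[l] \<in> ext_words G n" "u \<in> ext_words G n" by (cases l; simp)+
  then show ?case using Cons word_val_closed letter_val_closed by (simp add: m_assoc)
qed

lemma word_val_red:
  assumes "(u, v) \<in> ext_red G n"
  shows "word_val G g u = word_val G g v"
  using assms
proof cases
  case (unit a b)
  then show ?thesis using word_val_closed[of b] by (simp add: word_val_append)
next
  case (mult a b x y)
  then show ?thesis using word_val_closed[of b] by (simp add: word_val_append m_assoc)
next
  case (cancel a b i c)
  have "g ! i \<in> carrier G" using cancel g by (auto simp: subset_iff)
  then have "word_val G g ([Gen i c, Gen i (\<not> c)] @ b) = word_val G g b"
    using cancel word_val_closed[of b] by (simp add: m_assoc[symmetric])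
  then show ?thesis using cancel word_val_append[of a "[Gen i c, Gen i (\<not> c)] @ b"]
      word_val_append[of a b] by simp
qed

lemma word_val_cong:
  assumes "(u, v) \<in> ext_cong G n"
  shows "word_val G g u = word_val G g v"
proof -
  have "(u, v) \<in> (ext_red G n \<union> (ext_red G n)\<inverse>)\<^sup>*" using assms by (simp add: ext_cong_def)
  then show ?thesis
  proof induction
    case (step y z)
    then show ?case using word_val_red[of y z] word_val_red[of z y] by auto
  qed simp
qed

lemma ext_val_class:
  assumes "w \<in> ext_words G n"
  shows "ext_val G g (ext_cong G n `` {w}) = word_val G g w"
proof -
  have "w \<in> ext_cong G n `` {w}" using ext_cong_equiv[of G n] assms by (rule equiv_class_self)
  moreover have "word_val G g y = word_val G g w" if "y \<in> ext_cong G n `` {w}" for y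
    using word_val_cong[of w y] that by simp
  ultimately show ?thesis unfolding ext_val_def by (intro the_elem_image_unique) blast+
qed

lemma ext_val_hom:
  "ext_val G g \<in> hom (free_ext G n) G"
  "h \<in> carrier G \<Longrightarrow> ext_val G g (ext_cong G n `` {[Coef h]}) = h"
  "i < n \<Longrightarrow> ext_val G g (ext_cong G n `` {[Gen i True]}) = g ! i"
proof -
  show "ext_val G g \<in> hom (free_ext G n) G"
    by (rule homI)
      (auto elim!: free_ext_carrierE simp: ext_val_class ext_mult_class word_val_closed word_val_append)
  show "h \<in> carrier G \<Longrightarrow> ext_val G g (ext_cong G n `` {[Coef h]}) = h"
    by (simp add: ext_val_class)
  assume "i < n"
  moreover from this have "g ! i \<in> carrier G" using g by (auto simp: subset_iff)
  ultimately show "ext_val G g (ext_cong G n `` {[Gen i True]}) = g ! i"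
    by (simp add: ext_val_class)
qed

end

end

section \<open>First-order logic of groups\<close>

text \<open>\<open>TConst i\<close> is the new constant \<open>c\<^sub>i\<close> (counted from \<open>0\<close>); a formula of the language of
  groups is one without these constants, and a formula of \<open>\<L>\<^sub>n(c)\<close> one with constants below \<open>n\<close>.
  The sentence \<open>\<phi>(c)\<close> obtained from a formula \<open>\<phi>(x\<^sub>1,\<dots>,x\<^sub>n)\<close> is written directly with constants.\<close>

datatype trm = TVar nat | TConst nat | TOne | TInv trm | TMult trm trm

datatype fm = Eq trm trm | Neg fm | Conj fm fm | All nat fm | Ex nat fm

fun tvars :: "trm \<Rightarrow> nat set" where
  "tvars (TVar x) = {x}"
| "tvars (TConst i) = {}"
| "tvars TOne = {}"
| "tvars (TInv t) = tvars t"
| "tvars (TMult s t) = tvars s \<union> tvars t"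

fun tconsts :: "trm \<Rightarrow> nat set" where
  "tconsts (TVar x) = {}"
| "tconsts (TConst i) = {i}"
| "tconsts TOne = {}"
| "tconsts (TInv t) = tconsts t"
| "tconsts (TMult s t) = tconsts s \<union> tconsts t"

fun free_vars :: "fm \<Rightarrow> nat set" where
  "free_vars (Eq s t) = tvars s \<union> tvars t"
| "free_vars (Neg \<phi>) = free_vars \<phi>"
| "free_vars (Conj \<phi> \<psi>) = free_vars \<phi> \<union> free_vars \<psi>"
| "free_vars (All x \<phi>) = free_vars \<phi> - {x}"
| "free_vars (Ex x \<phi>) = free_vars \<phi> - {x}"

fun fconsts :: "fm \<Rightarrow> nat set" where
  "fconsts (Eq s t) = tconsts s \<union> tconsts t"
| "fconsts (Neg \<phi>) = fconsts \<phi>"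
| "fconsts (Conj \<phi> \<psi>) = fconsts \<phi> \<union> fconsts \<psi>"
| "fconsts (All x \<phi>) = fconsts \<phi>"
| "fconsts (Ex x \<phi>) = fconsts \<phi>"

fun quantifier_free :: "fm \<Rightarrow> bool" where
  "quantifier_free (Eq s t) = True"
| "quantifier_free (Neg \<phi>) = quantifier_free \<phi>"
| "quantifier_free (Conj \<phi> \<psi>) = (quantifier_free \<phi> \<and> quantifier_free \<psi>)"
| "quantifier_free (All x \<phi>) = False"
| "quantifier_free (Ex x \<phi>) = False"

inductive universal_fm :: "fm \<Rightarrow> bool" where
  "quantifier_free \<phi> \<Longrightarrow> universal_fm \<phi>"
| "universal_fm \<phi> \<Longrightarrow> universal_fm (All x \<phi>)"

inductive existential_fm :: "fm \<Rightarrow> bool" where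
  "quantifier_free \<phi> \<Longrightarrow> existential_fm \<phi>"
| "existential_fm \<phi> \<Longrightarrow> existential_fm (Ex x \<phi>)"

definition sentence :: "nat \<Rightarrow> fm \<Rightarrow> bool" where
  "sentence n \<phi> \<longleftrightarrow> fconsts \<phi> \<subseteq> {..<n} \<and> free_vars \<phi> = {}"

text \<open>A structure for \<open>\<L>\<^sub>n(c)\<close> is a pair of a group \<open>M\<close> and a list \<open>a\<close> of \<open>n\<close> elements interpreting
  the constants. Only groups are needed as structures: the group axioms are universal, so every
  model of the universal theory of a group is a group.\<close>

fun tval :: "('a, 'b) monoid_scheme \<Rightarrow> 'a list \<Rightarrow> (nat \<Rightarrow> 'a) \<Rightarrow> trm \<Rightarrow> 'a" where
  "tval M a e (TVar x) = e x"
| "tval M a e (TConst i) = a ! i"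
| "tval M a e TOne = \<one>\<^bsub>M\<^esub>"
| "tval M a e (TInv t) = inv\<^bsub>M\<^esub> (tval M a e t)"
| "tval M a e (TMult s t) = tval M a e s \<otimes>\<^bsub>M\<^esub> tval M a e t"

fun sat :: "('a, 'b) monoid_scheme \<Rightarrow> 'a list \<Rightarrow> (nat \<Rightarrow> 'a) \<Rightarrow> fm \<Rightarrow> bool" where
  "sat M a e (Eq s t) \<longleftrightarrow> tval M a e s = tval M a e t"
| "sat M a e (Neg \<phi>) \<longleftrightarrow> \<not> sat M a e \<phi>"
| "sat M a e (Conj \<phi> \<psi>) \<longleftrightarrow> sat M a e \<phi> \<and> sat M a e \<psi>"
| "sat M a e (All x \<phi>) \<longleftrightarrow> (\<forall>y\<in>carrier M. sat M a (e(x := y)) \<phi>)"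
| "sat M a e (Ex x \<phi>) \<longleftrightarrow> (\<exists>y\<in>carrier M. sat M a (e(x := y)) \<phi>)"

definition holds :: "('a, 'b) monoid_scheme \<Rightarrow> 'a list \<Rightarrow> fm \<Rightarrow> bool" where
  "holds M a \<phi> \<longleftrightarrow> (\<forall>e. range e \<subseteq> carrier M \<longrightarrow> sat M a e \<phi>)"

definition Th_univ :: "('a, 'b) monoid_scheme \<Rightarrow> fm set" where
  "Th_univ H = {\<phi>. sentence 0 \<phi> \<and> universal_fm \<phi> \<and> holds H [] \<phi>}"

definition models_univ :: "('h, 'r) monoid_scheme \<Rightarrow> ('a, 'c) monoid_scheme \<Rightarrow> bool" where
  "models_univ H M \<longleftrightarrow> group M \<and> (\<forall>\<phi>\<in>Th_univ H. holds M [] \<phi>)"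

definition limit_group :: "('h, 'r) monoid_scheme \<Rightarrow> ('a, 'c) monoid_scheme \<Rightarrow> bool" where
  "limit_group H G \<longleftrightarrow>
    models_univ H G \<and> (\<exists>A \<subseteq> carrier G. finite A \<and> generate G A = carrier G)"

section \<open>The rank\<close>

definition gen_tuple :: "('a, 'b) monoid_scheme \<Rightarrow> nat \<Rightarrow> 'a list \<Rightarrow> bool" where
  "gen_tuple M n a \<longleftrightarrow> length a = n \<and> set a \<subseteq> carrier M \<and> generate M (set a) = carrier M"

text \<open>A type is a set of formulas, whose free variables are the variables of the type. If there are
  none, the assignment \<open>e\<close> below is irrelevant and realizing means that all the sentences hold.\<close>

definition realizes :: "('a, 'b) monoid_scheme \<Rightarrow> 'a list \<Rightarrow> fm set \<Rightarrow> bool" where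
  "realizes M a p \<longleftrightarrow> (\<exists>e. range e \<subseteq> carrier M \<and> (\<forall>\<phi>\<in>p. sat M a e \<phi>))"

text \<open>The type \<open>p\<^sub>n(y)\<close>, with \<open>TVar 0\<close> as the variable \<open>y\<close>.\<close>

definition nongen_type :: "nat \<Rightarrow> fm set" where
  "nongen_type n = {Neg (Eq (TVar 0) t) | t. tvars t = {} \<and> tconsts t \<subseteq> {..<n}}"

definition univ_type :: "nat \<Rightarrow> ('a, 'b) monoid_scheme \<Rightarrow> 'a list \<Rightarrow> fm set" where
  "univ_type n M a = {\<phi>. sentence n \<phi> \<and> universal_fm \<phi> \<and> holds M a \<phi>}"

text \<open>The class \<open>\<K>(Th\<^sub>\<forall>(H) | P)\<close>. It is used only for sets \<open>P\<close> that contain \<open>p\<^sub>n\<close>. A structure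
  omitting \<open>p\<^sub>n\<close> is generated by the \<open>n\<close> constants, hence countable, and all notions involved are
  invariant under isomorphism; so nothing is lost by taking structures with carrier a set of
  natural numbers.\<close>

definition omit_class :: "('h, 'r) monoid_scheme \<Rightarrow> nat \<Rightarrow> fm set set \<Rightarrow> (nat monoid \<times> nat list) set" where
  "omit_class H n P =
    {(M, a). models_univ H M \<and> length a = n \<and> set a \<subseteq> carrier M \<and> (\<forall>p\<in>P. \<not> realizes M a p)}"

definition ex_supported :: "nat \<Rightarrow> fm set \<Rightarrow> (nat monoid \<times> nat list) set \<Rightarrow> bool" where
  "ex_supported n p K \<longleftrightarrow>
    (\<exists>\<psi>. sentence n \<psi> \<and> existential_fm \<psi> \<and> (\<exists>(M, a)\<in>K. holds M a \<psi>) \<and>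
         (\<forall>(M, a)\<in>K. holds M a \<psi> \<longrightarrow> realizes M a p))"

definition types_supported ::
  "('h, 'r) monoid_scheme \<Rightarrow> nat \<Rightarrow> fm set set \<Rightarrow> ('a, 'b) monoid_scheme \<Rightarrow> bool" where
  "types_supported H n P M \<longleftrightarrow>
    (\<forall>a. gen_tuple M n a \<longrightarrow> ex_supported n (univ_type n M a) (omit_class H n P))"

text \<open>Ordinals are elements of an arbitrary well-ordered type \<open>'o\<close>: the element \<open>\<alpha>\<close> stands for the
  order type of \<open>{..<\<alpha>}\<close>, so \<open>bot\<close> is the ordinal \<open>0\<close> and \<open>bot < \<alpha>\<close> says that \<open>\<alpha> \<ge> 1\<close>.
  \<open>rank_types H n \<alpha>\<close> is \<open>Q\<^bsub>n,\<alpha>\<^esub>\<close>. As above, the \<open>n\<close>-generated models occurring in it may be taken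
  on sets of natural numbers.\<close>

function rank_types :: "('h, 'r) monoid_scheme \<Rightarrow> nat \<Rightarrow> 'o::{wellorder,order_bot} \<Rightarrow> fm set set" where
  "rank_types H n \<alpha> = insert (nongen_type n)
    {univ_type n N b | (N :: nat monoid) b. models_univ H N \<and> gen_tuple N n b \<and>
       (\<exists>\<beta>\<in>{bot<..<\<alpha>}. types_supported H n (rank_types H n \<beta>) N)}"
  by auto
termination
  by (relation "inv_image {(\<beta>, \<alpha>). \<beta> < \<alpha>} (\<lambda>(H, n, \<alpha>). \<alpha>)") (auto intro: wf)

declare rank_types.simps [simp del]

text \<open>The relation \<open>Rk\<^sub>n(M) = \<alpha>\<close>. It holds for at most one \<open>\<alpha>\<close>: if it holds for \<open>\<alpha>\<close>, then the types
  of \<open>M\<close> belong to \<open>Q\<^bsub>n,\<beta>\<^esub>\<close> for all \<open>\<beta> > \<alpha>\<close>, and no sentence supports an omitted type.\<close>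

definition has_rank ::
  "('h, 'r) monoid_scheme \<Rightarrow> nat \<Rightarrow> ('a, 'b) monoid_scheme \<Rightarrow> 'o::{wellorder,order_bot} \<Rightarrow> bool" where
  "has_rank H n M \<alpha> \<longleftrightarrow> bot < \<alpha> \<and> types_supported H n (rank_types H n \<alpha>) M"

text \<open>The value \<open>Pinf\<close> means that the rank is no element of \<open>'o\<close>: it is \<open>\<infinity>\<close> or an ordinal beyond all
  those in \<open>'o\<close>. Hence for \<open>\<gamma> :: 'o\<close> with \<open>bot < \<gamma>\<close>, both \<open>Fin \<gamma> \<le> Rk H M\<close> and \<open>Rk H M = Fin \<gamma>\<close>
  have their intended meaning whatever the choice of \<open>'o\<close>.\<close>

definition Rk_n ::
  "('h, 'r) monoid_scheme \<Rightarrow> nat \<Rightarrow> ('a, 'b) monoid_scheme \<Rightarrow> 'o::{wellorder,order_bot} extended" where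
  "Rk_n H n M = (if \<exists>\<alpha>::'o. has_rank H n M \<alpha> then Fin (LEAST \<alpha>. has_rank H n M \<alpha>) else Pinf)"

text \<open>\<open>Rk_n H n M\<close> does not depend on the \<open>n \<ge> 1\<close> for which \<open>M\<close> is \<open>n\<close>-generated; the least one is
  taken.\<close>

definition Rk ::
  "('h, 'r) monoid_scheme \<Rightarrow> ('a, 'b) monoid_scheme \<Rightarrow> 'o::{wellorder,order_bot} extended" where
  "Rk H M = Rk_n H (LEAST n. 1 \<le> n \<and> (\<exists>a. gen_tuple M n a)) M"

end

theory Submission
  imports Defs "HOL-Algebra.Weak_Morphisms" "HOL-Library.Countable_Set"
begin

text \<open>The idea is that the rank of an \<open>n\<close>-generated model \<open>M\<close> of the universal theory of \<open>H\<close> is a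
  Cantor-Bendixson style rank that can be read off from the quotients of \<open>M\<close> alone. Since \<open>H\<close> is
  equationally noetherian, all the relations of a generating tuple \<open>a\<close> of \<open>M\<close> follow, in every model,
  from finitely many of them (\<open>finitely_many_relations\<close>); so one quantifier-free sentence says that the
  tuple interpreting the constants generates a quotient of \<open>M\<close> in which finitely many given
  nontrivial elements survive. Conversely, an existential sentence true in \<open>(M, a)\<close> remains true in
  every quotient of \<open>M\<close> in which a suitable finite set of nontrivial elements survives
  (\<open>hom_existential\<close>). Finally, a structure generated by its constants realizes the universal type
  of \<open>(M, a)\<close> only if it is isomorphic to \<open>(M, a)\<close>. Together this shows (\<open>has_rank_iff\<close>) that \<open>M\<close> has
  rank \<open>\<alpha>\<close> iff it has no smaller rank and there is a finite set \<open>X\<close> of nontrivial elements such that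
  every proper quotient of \<open>M\<close> that is a model and in which no element of \<open>X\<close> dies has rank less
  than \<open>\<alpha>\<close>. This condition mentions neither the generating tuple nor its length, so induction on
  \<open>\<alpha>\<close> shows that the rank does not depend on \<open>n\<close> (\<open>has_rank_independent\<close>).

  Given \<open>G\<close>, \<open>X\<close> and \<open>\<gamma>\<close>, consider the normal subgroups \<open>K\<close> of \<open>G\<close> that avoid \<open>X\<close> and for which \<open>G/K\<close> is a
  model of rank at least \<open>\<gamma>\<close>. The trivial subgroup is one of them, because \<open>\<gamma> \<le> Rk(G)\<close>, and the noetherian
  property yields a maximal one (\<open>ex_maximal_normal_subgroup\<close>). For a maximal \<open>K\<close>, all proper quotients
  of \<open>G/K\<close> that are models and in which \<open>X\<close> survives have rank less than \<open>\<gamma>\<close>, so the image of \<open>X\<close> witnesses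
  that the rank of \<open>G/K\<close> is exactly \<open>\<gamma>\<close>.\<close>

section \<open>Generating tuples and terms in the constants\<close>

instance trm :: countable
  by countable_datatype

definition closed_terms :: "nat \<Rightarrow> trm set" where
  "closed_terms n = {t. tvars t = {} \<and> tconsts t \<subseteq> {..<n}}"

text \<open>The value of a term without variables does not depend on the assignment; a constant one is
  fixed, and \<open>tval_closed_term\<close> moves any other assignment to it.\<close>

abbreviation cval :: "('a, 'b) monoid_scheme \<Rightarrow> 'a list \<Rightarrow> trm \<Rightarrow> 'a" where
  "cval M a \<equiv> tval M a (\<lambda>_. \<one>\<^bsub>M\<^esub>)"

lemma closed_terms_simps [simp]:
  "TConst i \<in> closed_terms n \<longleftrightarrow> i < n"
  "TOne \<in> closed_terms n"
  "TInv t \<in> closed_terms n \<longleftrightarrow> t \<in> closed_terms n"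
  "TMult s t \<in> closed_terms n \<longleftrightarrow> s \<in> closed_terms n \<and> t \<in> closed_terms n"
  by (auto simp: closed_terms_def)

lemma tval_env: "(\<And>x. x \<in> tvars t \<Longrightarrow> e x = e' x) \<Longrightarrow> tval M a e t = tval M a e' t"
  by (induction t) auto

lemma tval_closed_term: "t \<in> closed_terms n \<Longrightarrow> tval M a e t = cval M a t"
  by (rule tval_env) (simp add: closed_terms_def)

lemma sat_env: "(\<And>x. x \<in> free_vars \<phi> \<Longrightarrow> e x = e' x) \<Longrightarrow> sat M a e \<phi> = sat M a e' \<phi>"
proof (induction \<phi> arbitrary: e e')
  case (Eq s t)
  then show ?case using tval_env[of s e e' M a] tval_env[of t e e' M a] by simp
next
  case (Neg \<phi>)
  then show ?case by (metis free_vars.simps(2) sat.simps(2))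
next
  case (Conj \<phi> \<psi>)
  then show ?case by (metis UnI1 UnI2 free_vars.simps(3) sat.simps(3))
next
  case (All x \<phi>)
  have "sat M a (e(x := y)) \<phi> = sat M a (e'(x := y)) \<phi>" for y
    by (rule All.IH) (use All.prems in auto)
  then show ?case by simp
next
  case (Ex x \<phi>)
  have "sat M a (e(x := y)) \<phi> = sat M a (e'(x := y)) \<phi>" for y
    by (rule Ex.IH) (use Ex.prems in auto)
  then show ?case by simp
qed

lemma sat_sentence_env: "sentence n \<phi> \<Longrightarrow> sat M a e \<phi> = sat M a e' \<phi>"
  by (rule sat_env) (simp add: sentence_def)

lemma (in group) holds_iff_sat:
  assumes "sentence n \<phi>"
  shows "holds G a \<phi> \<longleftrightarrow> sat G a e \<phi>"
proof -
  have "range (\<lambda>_. \<one>) \<subseteq> carrier G" by auto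
  then show ?thesis using sat_sentence_env[OF assms] unfolding holds_def by metis
qed

lemma (in group) realizes_sentences_iff:
  assumes "\<And>\<phi>. \<phi> \<in> p \<Longrightarrow> sentence n \<phi>"
  shows "realizes G a p \<longleftrightarrow> (\<forall>\<phi>\<in>p. holds G a \<phi>)"
proof -
  have "range (\<lambda>_. \<one>) \<subseteq> carrier G" by auto
  then show ?thesis using assms holds_iff_sat sat_sentence_env unfolding realizes_def by metis
qed

context group
begin

lemma tval_carrier:
  assumes "set a \<subseteq> carrier G" "range e \<subseteq> carrier G" "tconsts t \<subseteq> {..<length a}"
  shows "tval G a e t \<in> carrier G"
  using assms by (induction t) (auto simp: subset_iff)

lemma cval_carrier:
  assumes "set a \<subseteq> carrier G" "t \<in> closed_terms (length a)"
  shows "cval G a t \<in> carrier G"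
  using assms by (intro tval_carrier) (auto simp: closed_terms_def)

lemma generate_eq_cval_image:
  assumes "set a \<subseteq> carrier G"
  shows "generate G (set a) = cval G a ` closed_terms (length a)"
proof (rule equalityI; rule subsetI)
  fix x assume "x \<in> generate G (set a)"
  then show "x \<in> cval G a ` closed_terms (length a)"
  proof (induction rule: generate.induct)
    case one
    show ?case by (rule image_eqI[of _ _ TOne]) auto
  next
    case (incl h)
    then obtain i where "i < length a" "a ! i = h" by (auto simp: in_set_conv_nth)
    then show ?case by (intro image_eqI[of _ _ "TConst i"]) auto
  next
    case (inv h)
    then obtain i where "i < length a" "a ! i = h" by (auto simp: in_set_conv_nth)
    then show ?case by (intro image_eqI[of _ _ "TInv (TConst i)"]) auto
  next
    case (eng h1 h2)
    then obtain s t where "s \<in> closed_terms (length a)" "t \<in> closed_terms (length a)"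
      "h1 = cval G a s" "h2 = cval G a t" by blast
    then show ?case by (intro image_eqI[of _ _ "TMult s t"]) auto
  qed
next
  fix x assume "x \<in> cval G a ` closed_terms (length a)"
  then obtain t where t: "t \<in> closed_terms (length a)" "x = cval G a t" by blast
  have "cval G a t \<in> generate G (set a)" using t(1)
  proof (induction t)
    case (TVar x)
    then show ?case by (simp add: closed_terms_def)
  next
    case (TConst i)
    then show ?case by (auto intro: generate.incl)
  next
    case (TInv t)
    then show ?case using generate_m_inv_closed[OF assms] by auto
  qed (auto intro: generate.intros)
  then show "x \<in> generate G (set a)" using t by simp
qed

lemma gen_tuple_iff:
  "gen_tuple G n a \<longleftrightarrow>
    length a = n \<and> set a \<subseteq> carrier G \<and> (\<forall>x\<in>carrier G. \<exists>t\<in>closed_terms n. cval G a t = x)"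
proof (cases "length a = n \<and> set a \<subseteq> carrier G")
  case True
  then have "generate G (set a) = carrier G \<longleftrightarrow> carrier G \<subseteq> cval G a ` closed_terms n"
    using generate_eq_cval_image[of a] generate_in_carrier by blast
  then show ?thesis using True unfolding gen_tuple_def by (auto simp: image_iff)
qed (auto simp: gen_tuple_def)

lemma gen_tuple_cvalE:
  assumes "gen_tuple G n a" "x \<in> carrier G"
  obtains t where "t \<in> closed_terms n" "cval G a t = x"
  using assms unfolding gen_tuple_iff by blast

lemma omits_nongen_type_iff:
  assumes "length a = n" "set a \<subseteq> carrier G"
  shows "\<not> realizes G a (nongen_type n) \<longleftrightarrow> gen_tuple G n a"
proof -
  have "realizes G a (nongen_type n) \<longleftrightarrow> (\<exists>x\<in>carrier G. \<forall>t\<in>closed_terms n. x \<noteq> cval G a t)"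
  proof
    assume "realizes G a (nongen_type n)"
    then obtain e where e: "range e \<subseteq> carrier G" "\<forall>\<phi>\<in>nongen_type n. sat G a e \<phi>"
      unfolding realizes_def by blast
    have "e 0 \<noteq> cval G a t" if "t \<in> closed_terms n" for t
    proof -
      have "sat G a e (Neg (Eq (TVar 0) t))"
        using that by (intro bspec[OF e(2)]) (auto simp: nongen_type_def closed_terms_def)
      then show ?thesis using tval_closed_term[OF that, of G a e] by simp
    qed
    moreover have "e 0 \<in> carrier G" using e by auto
    ultimately show "\<exists>x\<in>carrier G. \<forall>t\<in>closed_terms n. x \<noteq> cval G a t" by blast
  next
    assume "\<exists>x\<in>carrier G. \<forall>t\<in>closed_terms n. x \<noteq> cval G a t"
    then obtain x where x: "x \<in> carrier G" "\<forall>t\<in>closed_terms n. x \<noteq> cval G a t" by blast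
    have "sat G a (\<lambda>_. x) \<phi>" if \<phi>: "\<phi> \<in> nongen_type n" for \<phi>
    proof -
      obtain t where t: "\<phi> = Neg (Eq (TVar 0) t)" "t \<in> closed_terms n"
        using \<phi> by (auto simp: nongen_type_def closed_terms_def)
      then show ?thesis using x(2) tval_closed_term[OF t(2), of G a "\<lambda>_. x"] by simp
    qed
    then show "realizes G a (nongen_type n)"
      using x(1) unfolding realizes_def by (intro exI[of _ "\<lambda>_. x"]) auto
  qed
  then show ?thesis using assms unfolding gen_tuple_iff by metis
qed

lemma gen_tuple_countable:
  assumes "gen_tuple G n a"
  shows "countable (carrier G)"
proof -
  have "carrier G \<subseteq> cval G a ` closed_terms n" using gen_tuple_cvalE[OF assms] by blast
  moreover have "countable (cval G a ` closed_terms n)" by simp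
  ultimately show ?thesis by (rule Countable_Set.countable_subset)
qed

end

section \<open>Homomorphisms\<close>

lemma hom_tval:
  assumes "group M" "group N" "f \<in> hom M N"
    and "set a \<subseteq> carrier M" "range e \<subseteq> carrier M" "tconsts t \<subseteq> {..<length a}"
  shows "tval N (map f a) (f \<circ> e) t = f (tval M a e t)"
proof -
  interpret f: group_hom M N f using assms by (simp add: group_hom_def group_hom_axioms_def)
  show ?thesis using assms(6)
  proof (induction t)
    case (TInv t)
    then show ?case using f.G.tval_carrier[OF assms(4,5), of t] by simp
  next
    case (TMult s t)
    then show ?case
      using f.G.tval_carrier[OF assms(4,5), of s] f.G.tval_carrier[OF assms(4,5), of t] by simp
  qed auto
qed

lemma hom_cval:
  assumes "group M" "group N" "f \<in> hom M N"
    and "set a \<subseteq> carrier M" "t \<in> closed_terms (length a)"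
  shows "cval N (map f a) t = f (cval M a t)"
proof -
  interpret M: group M by fact
  have "range (\<lambda>_. \<one>\<^bsub>M\<^esub>) \<subseteq> carrier M" "tconsts t \<subseteq> {..<length a}"
    using assms(5) by (auto simp: closed_terms_def)
  from hom_tval[OF assms(1-4) this] show ?thesis
    using tval_closed_term[OF assms(5), of N "map f a" "f \<circ> (\<lambda>_. \<one>\<^bsub>M\<^esub>)"] by simp
qed

lemma epi_gen_tuple:
  assumes "group M" "group N" "f \<in> epi M N" "gen_tuple M n a"
  shows "gen_tuple N n (map f a)"
proof -
  interpret M: group M by fact
  interpret N: group N by fact
  have f: "f \<in> hom M N" "f ` carrier M = carrier N" using assms(3) by (auto simp: epi_def)
  have a: "length a = n" "set a \<subseteq> carrier M" using assms(4) by (auto simp: gen_tuple_def)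
  have "\<exists>t\<in>closed_terms n. cval N (map f a) t = y" if y: "y \<in> carrier N" for y
  proof -
    obtain x where x: "x \<in> carrier M" "y = f x" using y f(2) by blast
    obtain t where t: "t \<in> closed_terms n" "cval M a t = x"
      using M.gen_tuple_cvalE[OF assms(4) x(1)] .
    then have "cval N (map f a) t = f x" using hom_cval[OF assms(1,2) f(1)] a by simp
    then show ?thesis using t(1) x(2) by blast
  qed
  moreover have "length (map f a) = n" "set (map f a) \<subseteq> carrier N" using a f(2) by auto
  ultimately show ?thesis unfolding N.gen_tuple_iff by blast
qed

text \<open>The value at \<open>b\<close> of a closed term depends only on its value at \<open>a\<close>: two terms with the same
  value at \<open>a\<close> differ by a relation of \<open>a\<close>, hence by a relation of \<open>b\<close>.\<close>

lemma epi_of_relations: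
  assumes "group M" "group N" "gen_tuple M n a" "gen_tuple N n b"
    and rel: "\<And>t. t \<in> closed_terms n \<Longrightarrow> cval M a t = \<one>\<^bsub>M\<^esub> \<Longrightarrow> cval N b t = \<one>\<^bsub>N\<^esub>"
  obtains f where "f \<in> epi M N" "map f a = b"
proof -
  interpret M: group M by fact
  interpret N: group N by fact
  have a: "length a = n" "set a \<subseteq> carrier M" using assms(3) by (auto simp: gen_tuple_def)
  have b: "length b = n" "set b \<subseteq> carrier N" using assms(4) by (auto simp: gen_tuple_def)
  note Mc = M.cval_carrier[OF a(2), unfolded a(1)] and Nc = N.cval_carrier[OF b(2), unfolded b(1)]
  \<comment> \<open>The image of \<open>x\<close> is computed from an arbitrary term for \<open>x\<close>.\<close>
  define f where "f x = cval N b (SOME t. t \<in> closed_terms n \<and> cval M a t = x)" for x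
  have f: "f (cval M a t) = cval N b t" if t: "t \<in> closed_terms n" for t
  proof -
    define s where "s = (SOME s. s \<in> closed_terms n \<and> cval M a s = cval M a t)"
    have s: "s \<in> closed_terms n" "cval M a s = cval M a t"
      using someI[of "\<lambda>s. s \<in> closed_terms n \<and> cval M a s = cval M a t" t] t
      unfolding s_def by auto
    have "cval N b (TMult s (TInv t)) = \<one>\<^bsub>N\<^esub>"
      by (rule rel) (use s t Mc in auto)
    then have "cval N b s = cval N b t"
      using N.inv_equality[of "cval N b s" "inv\<^bsub>N\<^esub> cval N b t"] Nc[OF s(1)] Nc[OF t] by simp
    then show ?thesis unfolding f_def s_def[symmetric] .
  qed
  have hom: "f \<in> hom M N"
  proof (rule homI)
    fix x y assume "x \<in> carrier M" "y \<in> carrier M"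
    then obtain s t where "s \<in> closed_terms n" "t \<in> closed_terms n"
      "cval M a s = x" "cval M a t = y" using assms(3) by (metis M.gen_tuple_cvalE)
    then show "f (x \<otimes>\<^bsub>M\<^esub> y) = f x \<otimes>\<^bsub>N\<^esub> f y" "f x \<in> carrier N"
      using f[of "TMult s t"] f[of s] f[of t] Nc by auto
  qed
  have "y \<in> f ` carrier M" if y: "y \<in> carrier N" for y
  proof -
    obtain t where "t \<in> closed_terms n" "cval N b t = y"
      using N.gen_tuple_cvalE[OF assms(4) y] by blast
    then show ?thesis using f Mc by (metis imageI)
  qed
  then have "f \<in> epi M N" using hom by (auto simp: epi_iff_subset)
  moreover have "map f a = b"
    using f[of "TConst _"] a(1) b(1) by (intro nth_equalityI) auto
  ultimately show thesis by (rule that)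
qed

text \<open>Brings a finitely generated group into the range of \<open>omit_class\<close>, whose members have natural
  numbers as elements.\<close>

lemma (in group) countable_group_nat_copy:
  assumes "countable (carrier G)"
  obtains N :: "nat monoid" and f where "group N" "f \<in> iso G N"
proof -
  obtain f :: "'a \<Rightarrow> nat" where f: "inj_on f (carrier G)"
    using assms unfolding countable_def by blast
  show thesis
    using inj_imp_image_group_iso[OF f] inj_imp_image_group_is_group[OF f] that by blast
qed

section \<open>Transport along isomorphisms\<close>

lemma iso_sat:
  assumes "group M" "group N" "f \<in> iso M N"
    and "set a \<subseteq> carrier M" "range e \<subseteq> carrier M" "fconsts \<phi> \<subseteq> {..<length a}"
  shows "sat N (map f a) (f \<circ> e) \<phi> = sat M a e \<phi>"
  using assms(5,6)
proof (induction \<phi> arbitrary: e)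
  case (Eq s t)
  have f: "f \<in> hom M N" "inj_on f (carrier M)" using assms(3) by (auto simp: iso_iff)
  have "tval M a e s \<in> carrier M" "tval M a e t \<in> carrier M"
    using group.tval_carrier[OF assms(1,4)] Eq by auto
  moreover have "tval N (map f a) (f \<circ> e) s = f (tval M a e s)"
    "tval N (map f a) (f \<circ> e) t = f (tval M a e t)"
    using hom_tval[OF assms(1,2) f(1) assms(4)] Eq by auto
  ultimately show ?case by (simp only: sat.simps inj_on_eq_iff[OF f(2)])
next
  case (All x \<phi>)
  have im: "f ` carrier M = carrier N" using assms(3) by (auto simp: iso_iff)
  have "sat N (map f a) ((f \<circ> e)(x := f y)) \<phi> = sat M a (e(x := y)) \<phi>" if "y \<in> carrier M" for y
  proof -
    have "range (e(x := y)) \<subseteq> carrier M" "fconsts \<phi> \<subseteq> {..<length a}"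
      using All.prems that by auto
    from All.IH[OF this] show ?thesis by (simp only: fun_upd_comp)
  qed
  then show ?case unfolding sat.simps im[symmetric] by auto
next
  case (Ex x \<phi>)
  have im: "f ` carrier M = carrier N" using assms(3) by (auto simp: iso_iff)
  have "sat N (map f a) ((f \<circ> e)(x := f y)) \<phi> = sat M a (e(x := y)) \<phi>" if "y \<in> carrier M" for y
  proof -
    have "range (e(x := y)) \<subseteq> carrier M" "fconsts \<phi> \<subseteq> {..<length a}"
      using Ex.prems that by auto
    from Ex.IH[OF this] show ?thesis by (simp only: fun_upd_comp)
  qed
  then show ?case unfolding sat.simps im[symmetric] by auto
qed auto

lemma iso_holds:
  assumes "group M" "group N" "f \<in> iso M N" "set a \<subseteq> carrier M" "sentence (length a) \<phi>"
  shows "holds N (map f a) \<phi> = holds M a \<phi>"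
proof -
  interpret M: group M by fact
  interpret N: group N by fact
  have "range (\<lambda>_. \<one>\<^bsub>M\<^esub>) \<subseteq> carrier M" "fconsts \<phi> \<subseteq> {..<length a}"
    using assms(5) by (auto simp: sentence_def)
  from iso_sat[OF assms(1-4) this] show ?thesis
    using M.holds_iff_sat[OF assms(5)] N.holds_iff_sat[OF assms(5)] by metis
qed

lemma iso_univ_type:
  assumes "group M" "group N" "f \<in> iso M N" "set a \<subseteq> carrier M" "length a = n"
  shows "univ_type n N (map f a) = univ_type n M a"
  using iso_holds[OF assms(1-4)] assms(5) by (auto simp: univ_type_def)

lemma iso_models_univ:
  assumes "models_univ H M" "group N" "f \<in> iso M N"
  shows "models_univ H N"
  using assms iso_holds[of M N f "[]"] by (auto simp: models_univ_def Th_univ_def)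

lemma iso_is_epi: "f \<in> iso M N \<Longrightarrow> f \<in> epi M N"
  by (simp add: iso_iff_mon_epi)

lemma iso_types_supported:
  assumes "group M" "group N" "f \<in> iso M N" "types_supported H n P M"
  shows "types_supported H n P N"
  unfolding types_supported_def
proof (intro allI impI)
  fix b assume b: "gen_tuple N n b"
  define g where "g = inv_into (carrier M) f"
  have g: "g \<in> iso N M" unfolding g_def using group.iso_set_sym assms by blast
  have "gen_tuple M n (map g b)" using epi_gen_tuple[OF assms(2,1) iso_is_epi[OF g] b] .
  moreover have "univ_type n M (map g b) = univ_type n N b"
    using iso_univ_type[OF assms(2,1) g] b by (auto simp: gen_tuple_def)
  ultimately show "ex_supported n (univ_type n N b) (omit_class H n P)"
    using assms(4) unfolding types_supported_def by metis
qed

lemma iso_has_rank: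
  "group M \<Longrightarrow> group N \<Longrightarrow> f \<in> iso M N \<Longrightarrow> has_rank H n M \<alpha> \<Longrightarrow> has_rank H n N \<alpha>"
  unfolding has_rank_def using iso_types_supported by blast

text \<open>Equations between closed terms and their negations are universal sentences, so the universal
  type contains the whole multiplication table of \<open>(M, a)\<close>.\<close>

lemma realizes_univ_type_imp_iso:
  assumes "group M" "group N" "gen_tuple M n a" "gen_tuple N n b"
    and "realizes N b (univ_type n M a)"
  obtains f where "f \<in> iso M N" "map f a = b"
proof -
  interpret M: group M by fact
  interpret N: group N by fact
  have a: "length a = n" "set a \<subseteq> carrier M" using assms(3) by (auto simp: gen_tuple_def)
  have b: "length b = n" "set b \<subseteq> carrier N" using assms(4) by (auto simp: gen_tuple_def)
  have ty: "holds N b \<phi>" if "\<phi> \<in> univ_type n M a" for \<phi>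
    using assms(5) that N.realizes_sentences_iff[of "univ_type n M a" n b]
    by (auto simp: univ_type_def)
  have transfer: "holds N b \<phi>" if "holds M a \<phi>" "sentence n \<phi>" "quantifier_free \<phi>" for \<phi>
    using ty[of \<phi>] that by (simp add: univ_type_def universal_fm.intros)
  have rel: "cval N b t = \<one>\<^bsub>N\<^esub> \<longleftrightarrow> cval M a t = \<one>\<^bsub>M\<^esub>" if t: "t \<in> closed_terms n" for t
  proof -
    have s: "sentence n (Eq t TOne)" "sentence n (Neg (Eq t TOne))"
      using t by (auto simp: sentence_def closed_terms_def)
    show ?thesis
      using transfer[OF _ s(1)] transfer[OF _ s(2)]
      unfolding M.holds_iff_sat[OF s(1), of _ "\<lambda>_. \<one>\<^bsub>M\<^esub>"] M.holds_iff_sat[OF s(2), of _ "\<lambda>_. \<one>\<^bsub>M\<^esub>"]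
        N.holds_iff_sat[OF s(1), of _ "\<lambda>_. \<one>\<^bsub>N\<^esub>"] N.holds_iff_sat[OF s(2), of _ "\<lambda>_. \<one>\<^bsub>N\<^esub>"]
      by auto
  qed
  obtain f where f: "f \<in> epi M N" "map f a = b"
    using epi_of_relations[OF assms(1-4)] rel by blast
  have hom: "f \<in> hom M N" using f(1) by (simp add: epi_def)
  have "x = \<one>\<^bsub>M\<^esub>" if x: "x \<in> carrier M" "f x = \<one>\<^bsub>N\<^esub>" for x
  proof -
    obtain t where t: "t \<in> closed_terms n" "cval M a t = x"
      using M.gen_tuple_cvalE[OF assms(3) x(1)] by blast
    then show ?thesis using rel hom_cval[OF assms(1,2) hom a(2)] a(1) f(2) x(2) by metis
  qed
  then have "f \<in> iso M N"
    using f(1) hom assms(1,2) by (auto simp: iso_iff_mon_epi mon_iff_hom_one)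
  then show thesis using f(2) by (rule that)
qed

section \<open>Finite systems of equations\<close>

text \<open>The polarity \<open>p\<close> tells whether the word is for the term or for its inverse; this makes inversion
  a structural recursion that ends in letters. The clause for variables is a default value.\<close>

fun term_word :: "bool \<Rightarrow> trm \<Rightarrow> 'h letter list" where
  "term_word p (TVar x) = []"
| "term_word p (TConst i) = [Gen i p]"
| "term_word p TOne = []"
| "term_word p (TInv t) = term_word (\<not> p) t"
| "term_word p (TMult s t) =
    (if p then term_word p s @ term_word p t else term_word p t @ term_word p s)"

lemma term_word_ext: "t \<in> closed_terms n \<Longrightarrow> term_word p t \<in> ext_words H n"
  by (induction t arbitrary: p) auto

lemma (in group) word_val_term_word:
  assumes "length g = n" "set g \<subseteq> carrier G" "t \<in> closed_terms n"
  shows "word_val G g (term_word p t) = (if p then cval G g t else inv (cval G g t))"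
  using assms(3)
proof (induction t arbitrary: p)
  case (TVar x)
  then show ?case by (simp add: closed_terms_def)
next
  case (TConst i)
  then have "g ! i \<in> carrier G" using assms(1,2) by (auto simp: subset_iff)
  then show ?case by (simp add: word_val_def)
next
  case TOne
  then show ?case by (simp add: word_val_def)
next
  case (TInv t)
  then show ?case using cval_carrier[OF assms(2)] assms(1) by simp
next
  case (TMult s t)
  have st: "s \<in> closed_terms n" "t \<in> closed_terms n" using TMult.prems by auto
  then show ?case
    using TMult.IH word_val_append[OF assms(1,2) term_word_ext term_word_ext]
      cval_carrier[OF assms(2)] assms(1)
    by (auto simp: inv_mult_group)
qed

fun const_to_var :: "trm \<Rightarrow> trm" where
  "const_to_var (TVar x) = TVar x"
| "const_to_var (TConst i) = TVar i"
| "const_to_var TOne = TOne"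
| "const_to_var (TInv t) = TInv (const_to_var t)"
| "const_to_var (TMult s t) = TMult (const_to_var s) (const_to_var t)"

lemma const_to_var_closed:
  assumes "t \<in> closed_terms n"
  shows "tconsts (const_to_var t) = {}" "tvars (const_to_var t) \<subseteq> {..<n}"
  using assms by (induction t) (auto simp: closed_terms_def)

lemma tval_const_to_var:
  "t \<in> closed_terms n \<Longrightarrow> tval M [] e (const_to_var t) = cval M (map e [0..<n]) t"
  by (induction t) (auto simp: closed_terms_def)

definition conj_list :: "fm list \<Rightarrow> fm" where
  "conj_list \<phi>s = foldr Conj \<phi>s (Eq TOne TOne)"

lemma conj_list_simps [simp]:
  "sat M a e (conj_list \<phi>s) \<longleftrightarrow> (\<forall>\<phi>\<in>set \<phi>s. sat M a e \<phi>)"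
  "quantifier_free (conj_list \<phi>s) \<longleftrightarrow> (\<forall>\<phi>\<in>set \<phi>s. quantifier_free \<phi>)"
  "free_vars (conj_list \<phi>s) = (\<Union>\<phi>\<in>set \<phi>s. free_vars \<phi>)"
  "fconsts (conj_list \<phi>s) = (\<Union>\<phi>\<in>set \<phi>s. fconsts \<phi>)"
  by (induction \<phi>s) (auto simp: conj_list_def)

lemma foldr_All_simps:
  "universal_fm (foldr All xs \<phi>) \<longleftrightarrow> universal_fm \<phi>"
  "free_vars (foldr All xs \<phi>) = free_vars \<phi> - set xs"
  "fconsts (foldr All xs \<phi>) = fconsts \<phi>"
  by (induction xs) (auto intro: universal_fm.intros elim: universal_fm.cases)

text \<open>\<open>holds\<close> quantifies over all assignments, so it does not distinguish a formula from its closure.\<close>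

lemma holds_foldr_All:
  fixes M :: "('a, 'b) monoid_scheme"
  shows "holds M a (foldr All xs \<phi>) \<longleftrightarrow> holds M a \<phi>"
proof (induction xs)
  case (Cons x xs)
  have "holds M a (All x \<psi>) \<longleftrightarrow> holds M a \<psi>" for x \<psi>
  proof
    assume *: "holds M a (All x \<psi>)"
    show "holds M a \<psi>" unfolding holds_def
    proof (intro allI impI)
      fix e :: "nat \<Rightarrow> 'a" assume e: "range e \<subseteq> carrier M"
      then have "sat M a (e(x := e x)) \<psi>" using * unfolding holds_def sat.simps by blast
      then show "sat M a e \<psi>" by simp
    qed
  next
    assume *: "holds M a \<psi>"
    show "holds M a (All x \<psi>)" unfolding holds_def sat.simps
    proof (intro allI impI ballI)
      fix e :: "nat \<Rightarrow> 'a" and y assume "range e \<subseteq> carrier M" "y \<in> carrier M"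
      then have "range (e(x := y)) \<subseteq> carrier M" by auto
      then show "sat M a (e(x := y)) \<psi>" using * unfolding holds_def by blast
    qed
  qed
  then show ?case using Cons.IH by simp
qed simp

text \<open>The hypothesis on \<open>H\<close> is the universal sentence "if the finitely many words in \<open>T0\<close> vanish at
  \<open>x\<close>, then so does \<open>t\<close>", and is therefore inherited by every model.\<close>

lemma models_univ_implication:
  fixes H :: "('h, 'r) monoid_scheme"
  assumes M: "models_univ H M" and T: "finite T0" "T0 \<subseteq> closed_terms n" "t \<in> closed_terms n"
    and H: "\<And>g. \<lbrakk>length g = n; set g \<subseteq> carrier H; \<forall>s\<in>T0. cval H g s = \<one>\<^bsub>H\<^esub>\<rbrakk>
      \<Longrightarrow> cval H g t = \<one>\<^bsub>H\<^esub>"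
    and b: "length b = n" "set b \<subseteq> carrier M" "\<forall>s\<in>T0. cval M b s = \<one>\<^bsub>M\<^esub>"
  shows "cval M b t = \<one>\<^bsub>M\<^esub>"
proof -
  interpret M: group M using M by (simp add: models_univ_def)
  obtain ts where ts: "set ts = T0" using finite_list[OF T(1)] by blast
  define eq where "eq s = Eq (const_to_var s) TOne" for s
  define \<phi> where "\<phi> = Neg (Conj (conj_list (map eq ts)) (Neg (eq t)))"
  note c = const_to_var_closed
  have sat: "sat N [] e \<phi> \<longleftrightarrow>
      ((\<forall>s\<in>T0. cval N (map e [0..<n]) s = \<one>\<^bsub>N\<^esub>) \<longrightarrow> cval N (map e [0..<n]) t = \<one>\<^bsub>N\<^esub>)"
    for N :: "('x, 'y) monoid_scheme" and e
  proof -
    have "sat N [] e (eq s) \<longleftrightarrow> cval N (map e [0..<n]) s = \<one>\<^bsub>N\<^esub>" if "s \<in> closed_terms n" for s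
      using tval_const_to_var[OF that, of N e] by (simp add: eq_def)
    then show ?thesis using T(2,3) ts by (auto simp: \<phi>_def)
  qed
  have "holds H [] \<phi>"
    unfolding holds_def
  proof (intro allI impI)
    fix e :: "nat \<Rightarrow> 'h" assume e: "range e \<subseteq> carrier H"
    have "length (map e [0..<n]) = n" "set (map e [0..<n]) \<subseteq> carrier H" using e by auto
    then show "sat H [] e \<phi>" unfolding sat using H by blast
  qed
  moreover have "sentence 0 (foldr All [0..<n] \<phi>)"
  proof -
    have eq: "fconsts (eq s) = {}" "free_vars (eq s) \<subseteq> {..<n}" if "s \<in> insert t T0" for s
      using c[of s n] that T(2,3) by (auto simp: eq_def)
    have "fconsts \<phi> = {}" "free_vars \<phi> \<subseteq> {..<n}"
      using eq by (simp_all add: \<phi>_def ts UN_subset_iff)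
    then show ?thesis unfolding sentence_def foldr_All_simps by auto
  qed
  moreover have "universal_fm (foldr All [0..<n] \<phi>)"
    unfolding foldr_All_simps by (rule universal_fm.intros) (simp add: \<phi>_def eq_def)
  ultimately have "foldr All [0..<n] \<phi> \<in> Th_univ H"
    by (simp add: Th_univ_def holds_foldr_All)
  then have hM: "holds M [] \<phi>" using M by (auto simp: models_univ_def holds_foldr_All)
  define e where "e i = (if i < n then b ! i else \<one>\<^bsub>M\<^esub>)" for i
  have "range e \<subseteq> carrier M" using b(1,2) by (auto simp: e_def subset_iff)
  then have "sat M [] e \<phi>" using hM by (simp add: holds_def)
  moreover have "map e [0..<n] = b" using b(1) by (intro nth_equalityI) (auto simp: e_def)
  ultimately show ?thesis using sat[of M e] b(3) by simp
qed

text \<open>The equations in \<open>T\<close> are elements of the subgroup \<open>F(x)\<close> of \<open>H * F(x)\<close>, so the noetherian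
  property supplies a finite subsystem with the same solutions in \<open>H\<close>; that it has the same solutions
  in each model is then a matter of universal sentences, one for each member of \<open>T\<close>.\<close>

lemma finitely_many_relations:
  assumes "group H" "equationally_noetherian H" "1 \<le> n" "T \<subseteq> closed_terms n"
  obtains T0 where "finite T0" "T0 \<subseteq> T"
    "\<And>(M :: ('a, 'b) monoid_scheme) b t.
      \<lbrakk>models_univ H M; length b = n; set b \<subseteq> carrier M; \<forall>s\<in>T0. cval M b s = \<one>\<^bsub>M\<^esub>; t \<in> T\<rbrakk>
      \<Longrightarrow> cval M b t = \<one>\<^bsub>M\<^esub>"
proof -
  interpret H: group H by fact
  define w where "w t = ext_cong H n `` {term_word True t}" for t
  have val: "ext_val H g (w t) = cval H g t"
    if "length g = n" "set g \<subseteq> carrier H" "t \<in> closed_terms n" for g t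
    using H.ext_val_class[OF that(1,2) term_word_ext[OF that(3)]]
      H.word_val_term_word[OF that] by (simp add: w_def)
  have "w ` T \<subseteq> carrier (free_ext H n)"
    unfolding w_def using assms(4) by (intro image_subsetI free_ext_carrierI term_word_ext) blast
  then obtain S0 where S0: "S0 \<subseteq> w ` T" "finite S0"
    "solution_set H n (w ` T) = solution_set H n S0"
    using assms(2,3) unfolding equationally_noetherian_def by meson
  obtain T0 where T0: "T0 \<subseteq> T" "finite T0" "S0 = w ` T0"
    using finite_subset_image[OF S0(2,1)] by blast
  have rel: "cval H g t = \<one>\<^bsub>H\<^esub>" if "length g = n" "set g \<subseteq> carrier H"
    "\<forall>s\<in>T0. cval H g s = \<one>\<^bsub>H\<^esub>" "t \<in> T" for g t
  proof -
    have "g \<in> solution_set H n (w ` T0)"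
      using that val T0(1) assms(4) by (auto simp: solution_set_def subset_iff)
    then have "ext_val H g (w t) = \<one>\<^bsub>H\<^esub>" using S0(3) T0(3) that(4) by (auto simp: solution_set_def)
    then show ?thesis using val that assms(4) by (metis subsetD)
  qed
  show thesis
  proof (rule that[OF T0(2,1)])
    fix M :: "('a, 'b) monoid_scheme" and b t
    assume M: "models_univ H M" "length b = n" "set b \<subseteq> carrier M"
      "\<forall>s\<in>T0. cval M b s = \<one>\<^bsub>M\<^esub>" and t: "t \<in> T"
    have "T0 \<subseteq> closed_terms n" "t \<in> closed_terms n" using T0(1) t assms(4) by auto
    from models_univ_implication[OF M(1) T0(2) this rel[OF _ _ _ t] M(2-4)]
    show "cval M b t = \<one>\<^bsub>M\<^esub>" .
  qed
qed

section \<open>The rank in terms of quotients\<close>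

text \<open>Omitting the universal type of \<open>(M, a)\<close> means not being isomorphic to \<open>(M, a)\<close>, and having rank
  \<open>\<beta>\<close> is invariant under isomorphism; so omitting the types of rank less than \<open>\<alpha>\<close> amounts to having
  no rank less than \<open>\<alpha>\<close> oneself.\<close>

lemma omit_class_rank_types_iff:
  fixes N :: "nat monoid" and \<alpha> :: "'o::{wellorder,order_bot}"
  shows "(N, b) \<in> omit_class H n (rank_types H n \<alpha>) \<longleftrightarrow>
    models_univ H N \<and> gen_tuple N n b \<and> (\<forall>\<beta><\<alpha>. \<not> has_rank H n N \<beta>)"
proof (cases "models_univ H N \<and> length b = n \<and> set b \<subseteq> carrier N")
  case True
  then interpret N: group N by (simp add: models_univ_def)
  have types: "rank_types H n \<alpha> = insert (nongen_type n)
    {univ_type n N b | (N :: nat monoid) b. models_univ H N \<and> gen_tuple N n b \<and>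
       (\<exists>\<beta><\<alpha>. has_rank H n N \<beta>)}"
    unfolding rank_types.simps[of H n \<alpha>] has_rank_def by auto
  have "(N, b) \<in> omit_class H n (rank_types H n \<alpha>) \<longleftrightarrow> gen_tuple N n b \<and>
    (\<forall>(M :: nat monoid) a. models_univ H M \<and> gen_tuple M n a \<and> (\<exists>\<beta><\<alpha>. has_rank H n M \<beta>)
       \<longrightarrow> \<not> realizes N b (univ_type n M a))" (is "_ \<longleftrightarrow> _ \<and> ?omits")
  proof -
    have "(N, b) \<in> omit_class H n (rank_types H n \<alpha>) \<longleftrightarrow>
        (\<forall>p\<in>rank_types H n \<alpha>. \<not> realizes N b p)"
      using True by (simp add: omit_class_def)
    also have "\<dots> \<longleftrightarrow> gen_tuple N n b \<and> ?omits"
      unfolding types N.omits_nongen_type_iff[OF conjunct1[OF conjunct2[OF True]]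
          conjunct2[OF conjunct2[OF True]], symmetric] by blast
    finally show ?thesis .
  qed
  also have "\<dots> \<longleftrightarrow> gen_tuple N n b \<and> (\<forall>\<beta><\<alpha>. \<not> has_rank H n N \<beta>)"
  proof (intro conj_cong refl iffI)
    assume g: "gen_tuple N n b" and o: ?omits
    have "realizes N b (univ_type n N b)"
      using N.realizes_sentences_iff[of "univ_type n N b" n b] by (auto simp: univ_type_def)
    then show "\<forall>\<beta><\<alpha>. \<not> has_rank H n N \<beta>" using o g True by blast
  next
    assume g: "gen_tuple N n b" and r: "\<forall>\<beta><\<alpha>. \<not> has_rank H n N \<beta>"
    show ?omits
    proof (intro allI impI notI)
      fix M :: "nat monoid" and a
      assume M: "models_univ H M \<and> gen_tuple M n a \<and> (\<exists>\<beta><\<alpha>. has_rank H n M \<beta>)"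
        and re: "realizes N b (univ_type n M a)"
      then have gM: "group M" by (simp add: models_univ_def)
      obtain f where "f \<in> iso M N"
        using realizes_univ_type_imp_iso[OF gM N.is_group _ g re] M by blast
      then show False using M r iso_has_rank[OF gM N.is_group] by blast
    qed
  qed
  finally show ?thesis using True by simp
qed (auto simp: omit_class_def gen_tuple_def)

text \<open>A homomorphism preserves all equations; it preserves an inequation \<open>s \<noteq> t\<close> as soon as it does not
  kill \<open>s t\<^sup>-\<^sup>1\<close>. The set \<open>X\<close> collects these elements for the atomic formulas that are false in \<open>M\<close>.\<close>

lemma hom_quantifier_free:
  assumes M: "group M" and a: "set a \<subseteq> carrier M" and e: "range e \<subseteq> carrier M"
    and \<phi>: "quantifier_free \<phi>" "fconsts \<phi> \<subseteq> {..<length a}"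
  shows "\<exists>X. finite X \<and> X \<subseteq> carrier M - {\<one>\<^bsub>M\<^esub>} \<and>
    (\<forall>(N :: ('b, 'c) monoid_scheme) f. group N \<and> f \<in> hom M N \<and> \<one>\<^bsub>N\<^esub> \<notin> f ` X \<longrightarrow>
      sat N (map f a) (f \<circ> e) \<phi> = sat M a e \<phi>)"
  using \<phi>
proof (induction \<phi>)
  case (Eq s t)
  interpret M: group M by fact
  let ?x = "tval M a e s" and ?y = "tval M a e t"
  have xy: "?x \<in> carrier M" "?y \<in> carrier M" using M.tval_carrier[OF a e] Eq by auto
  define X where "X = {?x \<otimes>\<^bsub>M\<^esub> inv\<^bsub>M\<^esub> ?y} - {\<one>\<^bsub>M\<^esub>}"
  have "sat N (map f a) (f \<circ> e) (Eq s t) = sat M a e (Eq s t)"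
    if N: "group N" "f \<in> hom M N" "\<one>\<^bsub>N\<^esub> \<notin> f ` X" for N :: "('b, 'c) monoid_scheme" and f
  proof -
    interpret f: group_hom M N f using M N by (simp add: group_hom_def group_hom_axioms_def)
    have tv: "tval N (map f a) (f \<circ> e) s = f ?x" "tval N (map f a) (f \<circ> e) t = f ?y"
      using hom_tval[OF M N(1,2) a e] Eq by auto
    have "f ?x = f ?y \<longleftrightarrow> ?x = ?y"
    proof
      assume "f ?x = f ?y"
      then have "f (?x \<otimes>\<^bsub>M\<^esub> inv\<^bsub>M\<^esub> ?y) = \<one>\<^bsub>N\<^esub>" using xy by simp
      then have "?x \<otimes>\<^bsub>M\<^esub> inv\<^bsub>M\<^esub> ?y = \<one>\<^bsub>M\<^esub>" using N(3) unfolding X_def by force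
      then show "?x = ?y" using M.inv_equality[of ?x "inv\<^bsub>M\<^esub> ?y"] xy by simp
    qed simp
    then show ?thesis using tv by (simp only: sat.simps)
  qed
  moreover have "finite X" "X \<subseteq> carrier M - {\<one>\<^bsub>M\<^esub>}" using xy by (auto simp: X_def)
  ultimately show ?case by blast
next
  case (Conj \<phi> \<psi>)
  then obtain X Y where
    X: "finite X" "X \<subseteq> carrier M - {\<one>\<^bsub>M\<^esub>}" "\<And>(N :: ('b, 'c) monoid_scheme) f.
      group N \<Longrightarrow> f \<in> hom M N \<Longrightarrow> \<one>\<^bsub>N\<^esub> \<notin> f ` X \<Longrightarrow> sat N (map f a) (f \<circ> e) \<phi> = sat M a e \<phi>" and
    Y: "finite Y" "Y \<subseteq> carrier M - {\<one>\<^bsub>M\<^esub>}" "\<And>(N :: ('b, 'c) monoid_scheme) f.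
      group N \<Longrightarrow> f \<in> hom M N \<Longrightarrow> \<one>\<^bsub>N\<^esub> \<notin> f ` Y \<Longrightarrow> sat N (map f a) (f \<circ> e) \<psi> = sat M a e \<psi>"
    unfolding quantifier_free.simps fconsts.simps by (metis (no_types, lifting) Un_subset_iff)
  have "sat N (map f a) (f \<circ> e) (Conj \<phi> \<psi>) = sat M a e (Conj \<phi> \<psi>)"
    if N: "group N" "f \<in> hom M N" "\<one>\<^bsub>N\<^esub> \<notin> f ` (X \<union> Y)" for N :: "('b, 'c) monoid_scheme" and f
    using X(3)[OF N(1,2)] Y(3)[OF N(1,2)] N(3) unfolding sat.simps image_Un by blast
  moreover have "finite (X \<union> Y)" "X \<union> Y \<subseteq> carrier M - {\<one>\<^bsub>M\<^esub>}" using X(1,2) Y(1,2) by auto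
  ultimately show ?case by blast
next
  case (Neg \<phi>)
  then show ?case by (simp only: sat.simps quantifier_free.simps fconsts.simps simp_thms)
qed (simp_all only: quantifier_free.simps)

text \<open>Images of witnesses are witnesses, provided that the elements on which the truth of the
  quantifier-free part depends are not killed.\<close>

lemma hom_existential:
  assumes "existential_fm \<psi>"
    and M: "group M" and a: "set a \<subseteq> carrier M" and e: "range e \<subseteq> carrier M"
    and c: "fconsts \<psi> \<subseteq> {..<length a}" and s: "sat M a e \<psi>"
  shows "\<exists>X. finite X \<and> X \<subseteq> carrier M - {\<one>\<^bsub>M\<^esub>} \<and>
    (\<forall>(N :: ('b, 'c) monoid_scheme) f. group N \<and> f \<in> hom M N \<and> \<one>\<^bsub>N\<^esub> \<notin> f ` X \<longrightarrow>
      sat N (map f a) (f \<circ> e) \<psi>)"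
  using assms(1) e c s
proof (induction arbitrary: e)
  case (1 \<phi>)
  then show ?case using hom_quantifier_free[OF M a] by metis
next
  case (2 \<phi> x)
  then obtain y where y: "y \<in> carrier M" "sat M a (e(x := y)) \<phi>" by auto
  have "range (e(x := y)) \<subseteq> carrier M" "fconsts \<phi> \<subseteq> {..<length a}" using 2 y by auto
  from "2.IH"[OF this y(2)] obtain X where X: "finite X" "X \<subseteq> carrier M - {\<one>\<^bsub>M\<^esub>}"
    "\<And>(N :: ('b, 'c) monoid_scheme) f.
      group N \<Longrightarrow> f \<in> hom M N \<Longrightarrow> \<one>\<^bsub>N\<^esub> \<notin> f ` X \<Longrightarrow> sat N (map f a) (f \<circ> e(x := y)) \<phi>" by blast
  have "sat N (map f a) (f \<circ> e) (Ex x \<phi>)"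
    if N: "group N" "f \<in> hom M N" "\<one>\<^bsub>N\<^esub> \<notin> f ` X" for N :: "('b, 'c) monoid_scheme" and f
  proof -
    have "sat N (map f a) ((f \<circ> e)(x := f y)) \<phi>" using X(3)[OF N] by (simp only: fun_upd_comp)
    moreover have "f y \<in> carrier N" using N(2) y(1) by (auto simp: hom_def)
    ultimately show ?thesis unfolding sat.simps by blast
  qed
  then show ?case using X(1,2) by blast
qed

text \<open>The set \<open>X\<close> makes the algebraic form of a supporting sentence. Left to right, \<open>X\<close> is taken from
  \<open>hom_existential\<close> for the supporting sentence \<open>\<psi>\<close>: a quotient in which \<open>X\<close> survives and that has no
  smaller rank satisfies \<open>\<psi>\<close>, hence is isomorphic to \<open>M\<close> over the generators. Right to left, the
  supporting sentence says that a finite basis of the relations of \<open>a\<close> holds and that terms for the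
  elements of \<open>X\<close> are nontrivial.\<close>

lemma has_rank_iff:
  fixes M :: "('a, 'b) monoid_scheme" and \<alpha> :: "'o::{wellorder,order_bot}"
  assumes H: "group H" "equationally_noetherian H" and n: "1 \<le> n"
    and M: "models_univ H M" "gen_tuple M n a\<^sub>0" and \<alpha>: "bot < \<alpha>"
  shows "has_rank H n M \<alpha> \<longleftrightarrow> (\<forall>\<beta><\<alpha>. \<not> has_rank H n M \<beta>) \<and>
    (\<exists>X. finite X \<and> X \<subseteq> carrier M - {\<one>\<^bsub>M\<^esub>} \<and>
      (\<forall>(N :: nat monoid) f. models_univ H N \<and> f \<in> epi M N \<and> \<one>\<^bsub>N\<^esub> \<notin> f ` X \<and>
         \<not> inj_on f (carrier M) \<longrightarrow> (\<exists>\<beta><\<alpha>. has_rank H n N \<beta>)))" (is "_ \<longleftrightarrow> ?low \<and> ?isolated")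
proof
  interpret M: group M using M by (simp add: models_univ_def)
  let ?K = "omit_class H n (rank_types H n \<alpha>)"
  note K_iff = omit_class_rank_types_iff[of _ _ H n \<alpha>]
  {
    assume "has_rank H n M \<alpha>"
    then have "ex_supported n (univ_type n M a\<^sub>0) ?K"
      using M(2) by (auto simp: has_rank_def types_supported_def)
    then obtain \<psi> N\<^sub>0 b\<^sub>0 where \<psi>: "sentence n \<psi>" "existential_fm \<psi>"
      and N\<^sub>0: "(N\<^sub>0, b\<^sub>0) \<in> ?K" "holds N\<^sub>0 b\<^sub>0 \<psi>"
      and supp: "\<And>N b. (N, b) \<in> ?K \<Longrightarrow> holds N b \<psi> \<Longrightarrow> realizes N b (univ_type n M a\<^sub>0)"
      unfolding ex_supported_def by blast
    have gN\<^sub>0: "group N\<^sub>0" using N\<^sub>0(1) unfolding K_iff by (simp add: models_univ_def)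
    have a: "length a\<^sub>0 = n" "set a\<^sub>0 \<subseteq> carrier M" using M(2) by (auto simp: gen_tuple_def)
    obtain h where h: "h \<in> iso M N\<^sub>0" "map h a\<^sub>0 = b\<^sub>0"
      using realizes_univ_type_imp_iso[OF M.is_group gN\<^sub>0 M(2) _ supp[OF N\<^sub>0]] N\<^sub>0(1)
      unfolding K_iff by blast
    have ?low
      using iso_has_rank[OF M.is_group gN\<^sub>0 h(1)] N\<^sub>0(1) unfolding K_iff by blast
    have "holds M a\<^sub>0 \<psi>"
      using iso_holds[OF M.is_group gN\<^sub>0 h(1) a(2)] h(2) N\<^sub>0(2) \<psi>(1) a(1) by blast
    then have sat: "sat M a\<^sub>0 (\<lambda>_. \<one>\<^bsub>M\<^esub>) \<psi>" using M.holds_iff_sat[OF \<psi>(1)] by blast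
    have "range (\<lambda>_. \<one>\<^bsub>M\<^esub>) \<subseteq> carrier M" "fconsts \<psi> \<subseteq> {..<length a\<^sub>0}"
      using \<psi>(1) a(1) by (auto simp: sentence_def)
    then have "\<exists>X. finite X \<and> X \<subseteq> carrier M - {\<one>\<^bsub>M\<^esub>} \<and>
      (\<forall>(N :: nat monoid) f. group N \<and> f \<in> hom M N \<and> \<one>\<^bsub>N\<^esub> \<notin> f ` X \<longrightarrow>
        sat N (map f a\<^sub>0) (f \<circ> (\<lambda>_. \<one>\<^bsub>M\<^esub>)) \<psi>)"
      by (rule hom_existential[OF \<psi>(2) M.is_group a(2) _ _ sat])
    then obtain X where X: "finite X" "X \<subseteq> carrier M - {\<one>\<^bsub>M\<^esub>}"
      "\<And>(N :: nat monoid) f. group N \<Longrightarrow> f \<in> hom M N \<Longrightarrow> \<one>\<^bsub>N\<^esub> \<notin> f ` X \<Longrightarrow>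
        sat N (map f a\<^sub>0) (f \<circ> (\<lambda>_. \<one>\<^bsub>M\<^esub>)) \<psi>" by blast
    have "\<exists>\<beta><\<alpha>. has_rank H n N \<beta>"
      if N: "models_univ H N" "f \<in> epi M N" "\<one>\<^bsub>N\<^esub> \<notin> f ` X" "\<not> inj_on f (carrier M)"
      for N :: "nat monoid" and f
    proof (rule ccontr)
      assume no: "\<not> (\<exists>\<beta><\<alpha>. has_rank H n N \<beta>)"
      interpret N: group N using N(1) by (simp add: models_univ_def)
      have gen: "gen_tuple N n (map f a\<^sub>0)" using epi_gen_tuple[OF M.is_group N.is_group N(2) M(2)] .
      have hom: "f \<in> hom M N" using N(2) by (simp add: epi_def)
      have "(N, map f a\<^sub>0) \<in> ?K" using gen N(1) no unfolding K_iff by blast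
      moreover have "holds N (map f a\<^sub>0) \<psi>"
        using X(3)[OF N.is_group hom N(3)] N.holds_iff_sat[OF \<psi>(1)] by blast
      ultimately have "realizes N (map f a\<^sub>0) (univ_type n M a\<^sub>0)" by (rule supp)
      then obtain g where g: "g \<in> iso M N" "map g a\<^sub>0 = map f a\<^sub>0"
        using realizes_univ_type_imp_iso[OF M.is_group N.is_group M(2) gen] by blast
      \<comment> \<open>The isomorphism need not be given by \<open>f\<close>, but it agrees with \<open>f\<close> on the generators.\<close>
      have "f x = g x" if x: "x \<in> carrier M" for x
      proof -
        obtain t where t: "t \<in> closed_terms n" "cval M a\<^sub>0 t = x"
          using M.gen_tuple_cvalE[OF M(2) x] .
        then show ?thesis
          using hom_cval[OF M.is_group N.is_group hom a(2)]
            hom_cval[OF M.is_group N.is_group iso_imp_homomorphism[OF g(1)] a(2)] a(1) g(2) by metis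
      qed
      then show False using g(1) N(4) by (auto simp: iso_iff inj_on_def)
    qed
    then have ?isolated using X(1,2) by blast
    with \<open>?low\<close> show "?low \<and> ?isolated" ..
  }
  assume asm: "?low \<and> ?isolated"
  then obtain X where X: "finite X" "X \<subseteq> carrier M - {\<one>\<^bsub>M\<^esub>}"
    and low: "\<forall>(N :: nat monoid) f. models_univ H N \<and> f \<in> epi M N \<and> \<one>\<^bsub>N\<^esub> \<notin> f ` X \<and>
      \<not> inj_on f (carrier M) \<longrightarrow> (\<exists>\<beta><\<alpha>. has_rank H n N \<beta>)"
    by (elim conjE exE) (erule (2) that)
  have "ex_supported n (univ_type n M a) ?K" if gen: "gen_tuple M n a" for a
  proof -
    have a: "length a = n" "set a \<subseteq> carrier M" using gen by (auto simp: gen_tuple_def)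
    define R where "R = {t \<in> closed_terms n. cval M a t = \<one>\<^bsub>M\<^esub>}"
    have "R \<subseteq> closed_terms n" by (auto simp: R_def)
    then obtain R\<^sub>0 where R\<^sub>0: "finite R\<^sub>0" "R\<^sub>0 \<subseteq> R"
      "\<And>(N :: nat monoid) b t. \<lbrakk>models_univ H N; length b = n; set b \<subseteq> carrier N;
         \<forall>s\<in>R\<^sub>0. cval N b s = \<one>\<^bsub>N\<^esub>; t \<in> R\<rbrakk> \<Longrightarrow> cval N b t = \<one>\<^bsub>N\<^esub>"
      by (rule finitely_many_relations[OF H n]) blast
    have "\<forall>x\<in>X. \<exists>t. t \<in> closed_terms n \<and> cval M a t = x"
      using M.gen_tuple_cvalE[OF gen] X(2) by blast
    then obtain u where u: "\<And>x. x \<in> X \<Longrightarrow> u x \<in> closed_terms n \<and> cval M a (u x) = x" by metis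
    obtain rs where rs: "set rs = R\<^sub>0" using finite_list[OF R\<^sub>0(1)] by blast
    obtain xs where xs: "set xs = X" using finite_list[OF X(1)] by blast
    define \<psi> where "\<psi> = conj_list (map (\<lambda>t. Eq t TOne) rs @ map (\<lambda>x. Neg (Eq (u x) TOne)) xs)"
    have tm: "tconsts t \<subseteq> {..<n}" "tvars t = {}" if "t \<in> R\<^sub>0 \<union> u ` X" for t
      using that R\<^sub>0(2) u by (auto simp: R_def closed_terms_def)
    have \<psi>: "sentence n \<psi>" "existential_fm \<psi>"
      using tm by (auto simp: sentence_def \<psi>_def rs xs intro!: existential_fm.intros)
    have holds: "holds N b \<psi> \<longleftrightarrow>
        (\<forall>t\<in>R\<^sub>0. cval N b t = \<one>\<^bsub>N\<^esub>) \<and> (\<forall>x\<in>X. cval N b (u x) \<noteq> \<one>\<^bsub>N\<^esub>)"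
      if "group N" for N :: "nat monoid" and b
      unfolding group.holds_iff_sat[OF that \<psi>(1), of b "\<lambda>_. \<one>\<^bsub>N\<^esub>"]
      by (simp add: \<psi>_def rs xs ball_Un)
    \<comment> \<open>A supporting sentence must hold somewhere in the class: a copy of \<open>(M, a)\<close> serves.\<close>
    obtain N\<^sub>0 :: "nat monoid" and h where N\<^sub>0: "group N\<^sub>0" and h: "h \<in> iso M N\<^sub>0"
      using M.countable_group_nat_copy[OF M.gen_tuple_countable[OF gen]] .
    have hom: "h \<in> hom M N\<^sub>0" and inj: "inj_on h (carrier M)" using h by (auto simp: iso_iff)
    interpret h: group_hom M N\<^sub>0 h
      using N\<^sub>0 hom by (simp add: group_hom_def group_hom_axioms_def M.is_group)
    have "\<not> has_rank H n N\<^sub>0 \<beta>" if "\<beta> < \<alpha>" for \<beta>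
      using iso_has_rank[OF N\<^sub>0 M.is_group M.iso_set_sym[OF h]] asm that by blast
    then have inK: "(N\<^sub>0, map h a) \<in> ?K"
      using iso_models_univ[OF M(1) N\<^sub>0 h] epi_gen_tuple[OF M.is_group N\<^sub>0 iso_is_epi[OF h] gen]
      unfolding K_iff by blast
    have cvh: "cval N\<^sub>0 (map h a) t = \<one>\<^bsub>N\<^sub>0\<^esub> \<longleftrightarrow> cval M a t = \<one>\<^bsub>M\<^esub>" if t: "t \<in> closed_terms n" for t
      using hom_cval[OF M.is_group N\<^sub>0 hom a(2)] t a(1) M.cval_carrier[OF a(2)]
        inj_on_eq_iff[OF inj _ M.one_closed] by simp
    have "holds N\<^sub>0 (map h a) \<psi>"
      unfolding holds[OF N\<^sub>0] using cvh u X(2) R\<^sub>0(2) by (auto simp: R_def subset_iff)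
    moreover have "realizes N b (univ_type n M a)"
      if inK: "(N, b) \<in> ?K" and hN: "holds N b \<psi>" for N b
    proof -
      have N: "models_univ H N" "gen_tuple N n b" "\<forall>\<beta><\<alpha>. \<not> has_rank H n N \<beta>"
        using inK unfolding K_iff by auto
      interpret N: group N using N(1) by (simp add: models_univ_def)
      have b: "length b = n" "set b \<subseteq> carrier N" using N(2) by (auto simp: gen_tuple_def)
      have val: "\<forall>t\<in>R\<^sub>0. cval N b t = \<one>\<^bsub>N\<^esub>" "\<forall>x\<in>X. cval N b (u x) \<noteq> \<one>\<^bsub>N\<^esub>"
        using hN unfolding holds[OF N.is_group] by auto
      have "cval N b t = \<one>\<^bsub>N\<^esub>" if "t \<in> closed_terms n" "cval M a t = \<one>\<^bsub>M\<^esub>" for t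
        using R\<^sub>0(3)[OF N(1) b val(1)] that by (simp add: R_def)
      from epi_of_relations[OF M.is_group N.is_group gen N(2) this]
      obtain f where f: "f \<in> epi M N" "map f a = b" by blast
      have fhom: "f \<in> hom M N" using f(1) by (simp add: epi_def)
      have "f x \<noteq> \<one>\<^bsub>N\<^esub>" if x: "x \<in> X" for x
        using hom_cval[OF M.is_group N.is_group fhom a(2)] u[OF x] a(1) f(2) val(2) x by metis
      then have "\<one>\<^bsub>N\<^esub> \<notin> f ` X" by force
      then have "inj_on f (carrier M)" using low N(1,3) f(1) by blast
      then have "f \<in> iso M N" using f(1) by (auto simp: iso_iff epi_def)
      then have "univ_type n N b = univ_type n M a"
        using iso_univ_type[OF M.is_group N.is_group _ a(2,1)] f(2) by blast
      moreover have "realizes N b (univ_type n N b)"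
        using N.realizes_sentences_iff[of "univ_type n N b" n b] by (auto simp: univ_type_def)
      ultimately show ?thesis by simp
    qed
    ultimately show ?thesis using \<psi> inK unfolding ex_supported_def by blast
  qed
  then show "has_rank H n M \<alpha>" using \<alpha> by (auto simp: has_rank_def types_supported_def)
qed

text \<open>In \<open>has_rank_iff\<close> the number \<open>n\<close> occurs only in smaller ranks, of \<open>M\<close> and of its quotients. The
  induction runs over groups of natural numbers, where these quotients live, and the result is
  carried over to \<open>M\<close> by an isomorphic copy.\<close>

lemma has_rank_independent:
  fixes M :: "('a, 'b) monoid_scheme" and \<alpha> :: "'o::{wellorder,order_bot}"
  assumes H: "group H" "equationally_noetherian H" and nm: "1 \<le> n" "1 \<le> m"
    and M: "models_univ H M" "gen_tuple M n a" "gen_tuple M m b"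
  shows "has_rank H n M \<alpha> \<longleftrightarrow> has_rank H m M \<alpha>"
proof -
  have nat: "has_rank H n N \<alpha> \<longleftrightarrow> has_rank H m N \<alpha>"
    if "models_univ H N" "gen_tuple N n c" "gen_tuple N m d" for N :: "nat monoid" and c d
    using that
  proof (induction \<alpha> arbitrary: N c d rule: less_induct)
    case (less \<alpha>)
    show ?case
    proof (cases "bot < \<alpha>")
      case True
      have gN: "group N" using less.prems(1) by (simp add: models_univ_def)
      have low: "has_rank H n N \<beta> \<longleftrightarrow> has_rank H m N \<beta>" if "\<beta> < \<alpha>" for \<beta>
        using less.IH[OF that less.prems] .
      have quot: "has_rank H n L \<beta> \<longleftrightarrow> has_rank H m L \<beta>"
        if "\<beta> < \<alpha>" "models_univ H L" "f \<in> epi N L" for L :: "nat monoid" and f \<beta>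
      proof -
        have "group L" using that(2) by (simp add: models_univ_def)
        then show ?thesis
          using less.IH[OF that(1,2)] epi_gen_tuple[OF gN _ that(3)] less.prems(2,3) by blast
      qed
      have low': "(\<forall>\<beta><\<alpha>. \<not> has_rank H n N \<beta>) \<longleftrightarrow> (\<forall>\<beta><\<alpha>. \<not> has_rank H m N \<beta>)"
        using low by blast
      have quot': "(models_univ H L \<and> f \<in> epi N L \<and> P \<longrightarrow> (\<exists>\<beta><\<alpha>. has_rank H n L \<beta>)) \<longleftrightarrow>
          (models_univ H L \<and> f \<in> epi N L \<and> P \<longrightarrow> (\<exists>\<beta><\<alpha>. has_rank H m L \<beta>))"
        for L :: "nat monoid" and f P
        using quot by blast
      show ?thesis
        unfolding has_rank_iff[OF H nm(1) less.prems(1,2) True]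
          has_rank_iff[OF H nm(2) less.prems(1,3) True] low' quot' by (rule refl)
    qed (simp add: has_rank_def)
  qed
  have gM: "group M" using M(1) by (simp add: models_univ_def)
  obtain N :: "nat monoid" and h where N: "group N" "h \<in> iso M N"
    using group.countable_group_nat_copy[OF gM group.gen_tuple_countable[OF gM M(2)]] .
  have h': "inv_into (carrier M) h \<in> iso N M" using group.iso_set_sym[OF gM N(2)] .
  have "has_rank H k M \<alpha> \<longleftrightarrow> has_rank H k N \<alpha>" for k
    using iso_has_rank[OF gM N] iso_has_rank[OF N(1) gM h'] by blast
  then show ?thesis
    using nat[OF iso_models_univ[OF M(1) N] epi_gen_tuple[OF gM N(1) iso_is_epi[OF N(2)] M(2)]
        epi_gen_tuple[OF gM N(1) iso_is_epi[OF N(2)] M(3)]] by blast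
qed


section \<open>Quotients of prescribed rank\<close>

text \<open>Ascending chains stabilize: the relations that hold modulo the union of a chain follow from
  finitely many of them, and these already hold modulo a member \<open>K\<close> of the chain; as \<open>G/K\<close> is a model,
  all of them hold modulo \<open>K\<close>, so that \<open>K\<close> is the union.\<close>

lemma ex_maximal_normal_subgroup:
  fixes G :: "('a, 'b) monoid_scheme"
  assumes H: "group H" "equationally_noetherian H" and n: "1 \<le> n"
    and G: "group G" "gen_tuple G n a"
    and ne: "\<K> \<noteq> {}" and \<K>: "\<And>K. K \<in> \<K> \<Longrightarrow> K \<lhd> G \<and> models_univ H (G Mod K)"
  shows "\<exists>K\<in>\<K>. \<forall>K'\<in>\<K>. K \<subseteq> K' \<longrightarrow> K' = K"
proof (rule subset_Zorn_nonempty[OF ne])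
  interpret G: group G by fact
  have a: "length a = n" "set a \<subseteq> carrier G" using G(2) by (auto simp: gen_tuple_def)
  fix \<C> assume C: "\<C> \<noteq> {}" "subset.chain \<K> \<C>"
  define T where "T = {t \<in> closed_terms n. cval G a t \<in> \<Union>\<C>}"
  have "T \<subseteq> closed_terms n" by (auto simp: T_def)
  then obtain T\<^sub>0 where T\<^sub>0: "finite T\<^sub>0" "T\<^sub>0 \<subseteq> T"
    "\<And>(N :: 'a set monoid) b t. \<lbrakk>models_univ H N; length b = n; set b \<subseteq> carrier N;
       \<forall>s\<in>T\<^sub>0. cval N b s = \<one>\<^bsub>N\<^esub>; t \<in> T\<rbrakk> \<Longrightarrow> cval N b t = \<one>\<^bsub>N\<^esub>"
    by (rule finitely_many_relations[OF H n]) blast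
  have "finite (cval G a ` T\<^sub>0)" "cval G a ` T\<^sub>0 \<subseteq> \<Union>\<C>" using T\<^sub>0(1,2) by (auto simp: T_def)
  then obtain K where K: "K \<in> \<C>" "cval G a ` T\<^sub>0 \<subseteq> K"
    using finite_subset_Union_chain[OF _ _ C] by blast
  have KK: "K \<in> \<K>" using K(1) C(2) by (auto simp: subset_chain_def)
  then interpret K: normal K G using \<K> by blast
  let ?b = "map (\<lambda>x. K #>\<^bsub>G\<^esub> x) a"
  have N: "models_univ H (G Mod K)" using \<K> KK by blast
  have b: "length ?b = n" "set ?b \<subseteq> carrier (G Mod K)"
    using a by (auto simp: FactGroup_def RCOSETS_def)
  have cv: "cval (G Mod K) ?b t = \<one>\<^bsub>G Mod K\<^esub> \<longleftrightarrow> cval G a t \<in> K" if t: "t \<in> closed_terms n" for t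
  proof -
    have "cval (G Mod K) ?b t = K #>\<^bsub>G\<^esub> cval G a t"
      using hom_cval[OF G(1) K.factorgroup_is_group K.r_coset_hom_Mod a(2)] t a(1) by blast
    moreover have "cval G a t \<in> carrier G" using G.cval_carrier[OF a(2)] t a(1) by blast
    ultimately show ?thesis
      using G.coset_join1[OF _ _ K.subgroup_axioms] G.coset_join2[OF _ K.subgroup_axioms]
      by (metis K.subset one_FactGroup)
  qed
  have "\<forall>s\<in>T\<^sub>0. cval (G Mod K) ?b s = \<one>\<^bsub>G Mod K\<^esub>"
    using cv K(2) T\<^sub>0(2) by (auto simp: T_def)
  note basis = T\<^sub>0(3)[OF N b this]
  \<comment> \<open>Since \<open>K\<close> belongs to the chain, this inclusion says that \<open>K\<close> is the union.\<close>
  have "\<Union>\<C> \<subseteq> K"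
  proof
    fix x assume x: "x \<in> \<Union>\<C>"
    have "x \<in> carrier G"
      using x C(2) \<K> normal_imp_subgroup subgroup.subset by (fastforce simp: subset_chain_def)
    then obtain t where t: "t \<in> closed_terms n" "cval G a t = x"
      using G.gen_tuple_cvalE[OF G(2)] by blast
    then have "t \<in> T" using x by (simp add: T_def)
    then show "x \<in> K" using basis cv t by blast
  qed
  then have "\<Union>\<C> = K" using K(1) by blast
  then show "\<Union>\<C> \<in> \<K>" using KK by simp
qed

lemma limit_group_gen_tuple:
  assumes "limit_group H G"
  shows "\<exists>n\<ge>1. \<exists>a. gen_tuple G n a"
proof -
  interpret G: group G using assms by (simp add: limit_group_def models_univ_def)
  obtain A where A: "A \<subseteq> carrier G" "finite A" "generate G A = carrier G"
    using assms by (auto simp: limit_group_def)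
  obtain xs where xs: "set xs = A" using finite_list[OF A(2)] by blast
  have "carrier G \<subseteq> generate G (set (\<one>\<^bsub>G\<^esub> # xs))"
    using A(3) xs G.mono_generate[of A "set (\<one>\<^bsub>G\<^esub> # xs)"] by auto
  \<comment> \<open>The unit is prepended so that the tuple is nonempty even for the trivial group.\<close>
  then have "gen_tuple G (length (\<one>\<^bsub>G\<^esub> # xs)) (\<one>\<^bsub>G\<^esub> # xs)"
    using A(1) xs G.generate_incl[of "set (\<one>\<^bsub>G\<^esub> # xs)"] by (auto simp: gen_tuple_def)
  then show ?thesis by (intro exI[of _ "length (\<one>\<^bsub>G\<^esub> # xs)"]) auto
qed

lemma Rk_eq_Rk_n:
  fixes G :: "('a, 'b) monoid_scheme"
  assumes "limit_group H G"
  obtains n a where "1 \<le> n" "gen_tuple G n a"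
    "(Rk H G :: 'o::{wellorder,order_bot} extended) = Rk_n H n G"
proof -
  let ?n = "LEAST n. 1 \<le> n \<and> (\<exists>a. gen_tuple G n a)"
  have "1 \<le> ?n \<and> (\<exists>a. gen_tuple G ?n a)"
    using LeastI_ex[of "\<lambda>n. 1 \<le> n \<and> (\<exists>a. gen_tuple G n a)"] limit_group_gen_tuple[OF assms]
    by blast
  then show thesis using that[of ?n] unfolding Rk_def by blast
qed

lemma Fin_le_Rk_nD:
  fixes \<beta> \<gamma> :: "'o::{wellorder,order_bot}"
  assumes "Fin \<gamma> \<le> Rk_n H n G" "\<beta> < \<gamma>"
  shows "\<not> has_rank H n G \<beta>"
proof
  assume r: "has_rank H n G \<beta>"
  then have "(LEAST \<alpha>::'o. has_rank H n G \<alpha>) \<le> \<beta>" by (rule Least_le)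
  moreover have "Rk_n H n G = Fin (LEAST \<alpha>::'o. has_rank H n G \<alpha>)"
    using r unfolding Rk_n_def by auto
  ultimately show False using assms by simp
qed

lemma Rk_n_eqI:
  fixes \<gamma> :: "'o::{wellorder,order_bot}"
  assumes "has_rank H n G \<gamma>" "\<And>\<beta>. \<beta> < \<gamma> \<Longrightarrow> \<not> has_rank H n G \<beta>"
  shows "Rk_n H n G = Fin \<gamma>"
proof -
  have "(LEAST \<alpha>. has_rank H n G \<alpha>) = \<gamma>"
    using assms by (intro Least_equality) (auto simp: not_less[symmetric])
  then show ?thesis using assms(1) unfolding Rk_n_def by auto
qed

theorem theorem6p3:
  fixes H :: "'h monoid" and G :: "'g monoid" and X :: "'g set"
    and \<gamma> :: "'o::{wellorder,order_bot}"
  assumes "group H" and "equationally_noetherian H"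
    and "limit_group H G"
    and "finite X" and "X \<subseteq> carrier G - {\<one>\<^bsub>G\<^esub>}"
    and "bot < \<gamma>" and "Fin \<gamma> \<le> Rk H G"
  shows "\<exists>(L :: 'g set monoid) f. f \<in> epi G L \<and> limit_group H L \<and> Rk H L = Fin \<gamma> \<and>
    \<one>\<^bsub>L\<^esub> \<notin> f ` X"
proof -
  note H = assms(1,2)
  have mG: "models_univ H G" using assms(3) by (simp add: limit_group_def)
  then interpret G: group G by (simp add: models_univ_def)
  obtain n a where n: "1 \<le> n" and gen: "gen_tuple G n a"
    and Rk: "(Rk H G :: 'o extended) = Rk_n H n G"
    using Rk_eq_Rk_n[OF assms(3)] by blast
  \<comment> \<open>Having no rank less than \<open>\<gamma>\<close> expresses that the rank is at least \<open>\<gamma>\<close>, without presupposing that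
    there is an ordinal in \<open>'o\<close> that is the rank.\<close>
  define \<K> where "\<K> = {K. K \<lhd> G \<and> models_univ H (G Mod K) \<and> X \<inter> K = {} \<and>
    (\<forall>\<beta><\<gamma>. \<not> has_rank H n (G Mod K) \<beta>)}"
  have "{\<one>\<^bsub>G\<^esub>} \<in> \<K>"
  proof -
    have nor: "{\<one>\<^bsub>G\<^esub>} \<lhd> G" by (rule G.one_is_normal)
    have grp: "group (G Mod {\<one>\<^bsub>G\<^esub>})" using normal.factorgroup_is_group[OF nor] .
    have i: "the_elem \<in> iso (G Mod {\<one>\<^bsub>G\<^esub>}) G" by (rule G.trivial_factor_iso)
    have "models_univ H (G Mod {\<one>\<^bsub>G\<^esub>})"
      using iso_models_univ[OF mG grp] group.iso_set_sym[OF grp i] by blast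
    moreover have "\<not> has_rank H n (G Mod {\<one>\<^bsub>G\<^esub>}) \<beta>" if "\<beta> < \<gamma>" for \<beta>
      using iso_has_rank[OF grp G.is_group i] Fin_le_Rk_nD[of \<gamma> H n G \<beta>] assms(7) that
      unfolding Rk by blast
    ultimately show ?thesis using nor assms(5) by (auto simp: \<K>_def)
  qed
  then have "\<K> \<noteq> {}" by blast
  then have "\<exists>K\<in>\<K>. \<forall>K'\<in>\<K>. K \<subseteq> K' \<longrightarrow> K' = K"
    by (rule ex_maximal_normal_subgroup[OF H n G.is_group gen]) (simp add: \<K>_def)
  then obtain K where K: "K \<in> \<K>" and max: "\<And>K'. K' \<in> \<K> \<Longrightarrow> K \<subseteq> K' \<Longrightarrow> K' = K" by blast
  interpret K: normal K G using K by (simp add: \<K>_def)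
  define L where "L = G Mod K"
  define \<pi> where "\<pi> = (\<lambda>x. K #>\<^bsub>G\<^esub> x)"
  have mL: "models_univ H L" and low: "\<And>\<beta>. \<beta> < \<gamma> \<Longrightarrow> \<not> has_rank H n L \<beta>"
    and XK: "X \<inter> K = {}" using K by (auto simp: \<K>_def L_def)
  interpret L: group L unfolding L_def by (rule K.factorgroup_is_group)
  have hom: "\<pi> \<in> hom G L" unfolding \<pi>_def L_def by (rule K.r_coset_hom_Mod)
  have im: "\<pi> ` carrier G = carrier L" by (auto simp: \<pi>_def L_def FactGroup_def RCOSETS_def)
  have epi: "\<pi> \<in> epi G L" using hom im by (simp add: epi_def)
  have one: "\<pi> x = \<one>\<^bsub>L\<^esub> \<longleftrightarrow> x \<in> K" if "x \<in> carrier G" for x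
    using G.coset_join1[OF _ that K.subgroup_axioms] G.coset_join2[OF that K.subgroup_axioms] K.subset
    unfolding \<pi>_def L_def by (metis one_FactGroup)
  have X1: "\<one>\<^bsub>L\<^esub> \<notin> \<pi> ` X"
  proof
    assume "\<one>\<^bsub>L\<^esub> \<in> \<pi> ` X"
    then obtain x where "x \<in> X" "\<pi> x = \<one>\<^bsub>L\<^esub>" by auto
    then show False using one[of x] XK assms(5) by blast
  qed
  have quot: "\<exists>\<beta><\<gamma>. has_rank H n N \<beta>"
    if N: "models_univ H N" "f \<in> epi L N" "\<one>\<^bsub>N\<^esub> \<notin> f ` \<pi> ` X" "\<not> inj_on f (carrier L)"
    for N :: "nat monoid" and f
  proof (rule ccontr)
    assume no: "\<not> (\<exists>\<beta><\<gamma>. has_rank H n N \<beta>)"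
    interpret N: group N using N(1) by (simp add: models_univ_def)
    have fhom: "f \<in> hom L N" and fim: "f ` carrier L = carrier N" using N(2) by (auto simp: epi_def)
    interpret f: group_hom L N f
      using fhom by (simp add: group_hom_def group_hom_axioms_def L.is_group N.is_group)
    interpret h: group_hom G N "f \<circ> \<pi>"
      using hom_compose[OF hom fhom]
      by (simp add: group_hom_def group_hom_axioms_def G.is_group N.is_group)
    \<comment> \<open>Were the rank of \<open>N\<close> at least \<open>\<gamma>\<close>, the kernel of \<open>G \<rightarrow> N\<close> would contradict the maximality of \<open>K\<close>.\<close>
    define K' where "K' = kernel G N (f \<circ> \<pi>)"
    have nor: "K' \<lhd> G" unfolding K'_def by (rule h.normal_kernel)
    have grp: "group (G Mod K')" using normal.factorgroup_is_group[OF nor] .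
    have "(f \<circ> \<pi>) ` carrier G = carrier N" unfolding image_comp[symmetric] im by (rule fim)
    from h.FactGroup_iso_set[OF this] obtain i where i: "i \<in> iso (G Mod K') N"
      unfolding K'_def by blast
    have "models_univ H (G Mod K')"
      using iso_models_univ[OF N(1) grp group.iso_set_sym[OF grp i]] .
    moreover have "\<not> has_rank H n (G Mod K') \<beta>" if "\<beta> < \<gamma>" for \<beta>
      using iso_has_rank[OF grp N.is_group i] no that by blast
    moreover have "X \<inter> K' = {}" using N(3) by (force simp: K'_def kernel_def)
    ultimately have "K' \<in> \<K>" using nor by (simp add: \<K>_def)
    moreover have "K \<subseteq> K'"
    proof
      fix x assume "x \<in> K"
      then have "x \<in> carrier G" "\<pi> x = \<one>\<^bsub>L\<^esub>" using one K.subset by auto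
      then show "x \<in> K'" by (simp add: K'_def kernel_def)
    qed
    ultimately have "K' = K" by (rule max)
    have "y = \<one>\<^bsub>L\<^esub>" if y: "y \<in> carrier L" "f y = \<one>\<^bsub>N\<^esub>" for y
    proof -
      obtain x where x: "x \<in> carrier G" "y = \<pi> x" using y(1) im by blast
      then have "x \<in> K'" using y(2) by (simp add: K'_def kernel_def)
      then show ?thesis using one x \<open>K' = K\<close> by blast
    qed
    then show False using N(4) f.inj_on_one_iff by blast
  qed
  have genL: "gen_tuple L n (map \<pi> a)" using epi_gen_tuple[OF G.is_group L.is_group epi gen] .
  have "finite (\<pi> ` X)" "\<pi> ` X \<subseteq> carrier L - {\<one>\<^bsub>L\<^esub>}" using assms(4,5) im X1 by auto
  then have rank: "has_rank H n L \<gamma>"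
    unfolding has_rank_iff[OF H n mL genL assms(6)]
    by (intro conjI exI[of _ "\<pi> ` X"] allI impI low) (auto intro: quot)
  have "finite (set (map \<pi> a))" by simp
  then have lim: "limit_group H L"
    using mL genL unfolding limit_group_def gen_tuple_def by blast
  obtain m b where m: "1 \<le> m" and b: "gen_tuple L m b"
    and RkL: "(Rk H L :: 'o extended) = Rk_n H m L"
    using Rk_eq_Rk_n[OF lim] by blast
  have "Rk_n H m L = Fin \<gamma>"
    using Rk_n_eqI[of H m L \<gamma>] rank low has_rank_independent[OF H n m mL genL b] by blast
  then show ?thesis using epi lim X1 RkL by auto
qed

end
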